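(* Let $G$ be a graph whose edge set can be partitioned into $k$ Hamiltonian paths of $G$. Then $\theta(4,F_2(G))=k$.
   Context: A Hamiltonian path of $G$ is a path in $G$ containing every vertex of $G$; a factorization of $G$ into $k$ Hamiltonian paths is a partition of $E(G)$ into $k$ sets, each forming a Hamiltonian path. The $2$-token graph $F_2(G)$ has as vertices all $2$-element subsets of $V(G)$, two such subsets $X,Y$ being adjacent iff their symmetric difference is $\{x,y\}$ with $x\in X$, $y\in Y$ and $xy\in E(G)$. The girth of a graph is the length of its shortest cycle, or $\infty$ if it is acyclic. The $g$-girth-thickness $\theta(g,H)$ of a graph $H$ is the minimum number of planar subgraphs of $H$, each of girth at least $g$, whose union is $H$ (equivalently, the minimum number of parts in a partition of $E(H)$ such that each part induces a planar graph of girth at least $g$). *)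

theory Defs
  imports "HOL-Analysis.Analysis" "HOL-Library.Disjoint_Sets" "HOL-Library.Extended_Nat"
begin

type_synonym 'a ugraph = "'a set \<times> 'a set set"

abbreviation verts :: "'a ugraph \<Rightarrow> 'a set" where "verts G \<equiv> fst G"
abbreviation edges :: "'a ugraph \<Rightarrow> 'a set set" where "edges G \<equiv> snd G"

definition simple_graph :: "'a ugraph \<Rightarrow> bool" where
  "simple_graph G \<longleftrightarrow> finite (verts G) \<and> (\<forall>e\<in>edges G. e \<subseteq> verts G \<and> card e = 2)"

definition subgraph :: "'a ugraph \<Rightarrow> 'a ugraph \<Rightarrow> bool" where
  "subgraph H G \<longleftrightarrow> simple_graph H \<and> verts H \<subseteq> verts G \<and> edges H \<subseteq> edges G"

definition path_edges :: "'a list \<Rightarrow> 'a set set" where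
  "path_edges xs = {{xs ! i, xs ! Suc i} | i. Suc i < length xs}"

definition is_path :: "'a ugraph \<Rightarrow> 'a list \<Rightarrow> bool" where
  "is_path G xs \<longleftrightarrow> xs \<noteq> [] \<and> distinct xs \<and> set xs \<subseteq> verts G \<and> path_edges xs \<subseteq> edges G"

definition hamiltonian_path :: "'a ugraph \<Rightarrow> 'a list \<Rightarrow> bool" where
  "hamiltonian_path G xs \<longleftrightarrow> is_path G xs \<and> set xs = verts G"

text \<open>The parts of a partition are nonempty, so the trivial path on a one-vertex graph
  does not count as a part.\<close>

definition hamiltonian_path_factorization :: "'a ugraph \<Rightarrow> nat \<Rightarrow> bool" where
  "hamiltonian_path_factorization G k \<longleftrightarrow>
     (\<exists>P. partition_on (edges G) P \<and> finite P \<and> card P = k \<and>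
          (\<forall>p\<in>P. \<exists>xs. hamiltonian_path G xs \<and> p = path_edges xs))"

definition token_graph :: "nat \<Rightarrow> 'a ugraph \<Rightarrow> 'a set ugraph" where
  "token_graph t G =
     ({X. X \<subseteq> verts G \<and> finite X \<and> card X = t},
      {{X, Y} | X Y. X \<subseteq> verts G \<and> finite X \<and> card X = t \<and>
                     Y \<subseteq> verts G \<and> finite Y \<and> card Y = t \<and>
                     (\<exists>x\<in>X. \<exists>y\<in>Y. sym_diff X Y = {x, y} \<and> {x, y} \<in> edges G)})"

definition is_cycle :: "'a ugraph \<Rightarrow> 'a list \<Rightarrow> bool" where
  "is_cycle G c \<longleftrightarrow> 3 \<le> length c \<and> is_path G c \<and> {last c, hd c} \<in> edges G"

text \<open>The infimum of the empty set in \<^typ>\<open>enat\<close> is infinity, so acyclic graphs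
  have infinite girth.\<close>

definition girth :: "'a ugraph \<Rightarrow> enat" where
  "girth G = (INF c\<in>{c. is_cycle G c}. enat (length c))"

text \<open>A plane drawing: vertices are distinct points, edges are simple arcs joining their
  end vertices, avoiding all other vertices, and meeting each other only in common end
  vertices. The Euclidean plane is represented by \<^typ>\<open>complex\<close>.\<close>

definition plane_drawing ::
    "'a ugraph \<Rightarrow> ('a \<Rightarrow> complex) \<Rightarrow> ('a set \<Rightarrow> real \<Rightarrow> complex) \<Rightarrow> bool" where
  "plane_drawing G \<phi> \<gamma> \<longleftrightarrow>
     inj_on \<phi> (verts G) \<and>
     (\<forall>e\<in>edges G. arc (\<gamma> e) \<and> {pathstart (\<gamma> e), pathfinish (\<gamma> e)} = \<phi> ` e \<and>
                   path_image (\<gamma> e) \<inter> \<phi> ` verts G = \<phi> ` e) \<and>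
     (\<forall>e\<in>edges G. \<forall>f\<in>edges G. e \<noteq> f \<longrightarrow>
        path_image (\<gamma> e) \<inter> path_image (\<gamma> f) = \<phi> ` (e \<inter> f))"

definition planar :: "'a ugraph \<Rightarrow> bool" where
  "planar G \<longleftrightarrow> (\<exists>\<phi> \<gamma>. plane_drawing G \<phi> \<gamma>)"

text \<open>The union of a family of subgraphs must cover the vertices as well as the edges. A
  finite simple graph is the union of its one-vertex and one-edge subgraphs, so the minimum
  is over a nonempty set.\<close>

definition girth_thickness :: "nat \<Rightarrow> 'a ugraph \<Rightarrow> nat" where
  "girth_thickness g H =
     (LEAST m. \<exists>S. finite S \<and> card S = m \<and>
        (\<forall>K\<in>S. subgraph K H \<and> planar K \<and> enat g \<le> girth K) \<and>
        (\<Union>K\<in>S. verts K) = verts H \<and> (\<Union>K\<in>S. edges K) = edges H)"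

end

theory Submission imports Defs begin

text \<open>
  Upper bound: for a path with vertices \<open>x\<^sub>0, \<dots>, x\<^sub>n\<close> placing the token pair
  \<open>{x\<^sub>i, x\<^sub>j}\<close> with \<open>i < j\<close> at the grid point \<open>(i, j)\<close> draws its 2-token graph with unit
  grid segments, so that graph is planar and bipartite. The \<open>k\<close> Hamiltonian paths therefore
  split the 2-token graph of \<open>G\<close> into \<open>k\<close> planar graphs of girth at least 4.

  Lower bound: a nonempty plane graph of girth at least 4 with \<open>N\<close> vertices has at most
  \<open>2 N - 2\<close> edges. With \<open>n\<close> vertices in \<open>G\<close>, the 2-token graph has \<open>n (n - 1) / 2\<close> vertices and
  \<open>k (n - 1) (n - 2)\<close> edges, so \<open>m\<close> parts require \<open>k (n - 1) \<le> m (n + 1)\<close> when \<open>n > 2\<close>. Together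
  with \<open>2 k \<le> n\<close>, which holds since \<open>G\<close> has at most \<open>n (n - 1) / 2\<close> edges, this forces \<open>k \<le> m\<close>.

  The edge bound avoids faces and Euler's formula. A minimal counterexample has no separation of
  order at most one, so every cycle \<open>C\<close> with something inside it has an ear inside it. Splitting
  along ears with the theta-curve theorem shows that the part of the drawing on and inside \<open>C\<close>
  satisfies \<open>2 e \<le> 4 v - 4 - |C|\<close>. An inversion of the plane centred inside \<open>C\<close> yields the same for
  the part on and outside \<open>C\<close>, and adding the two gives \<open>e \<le> 2 N - 4\<close>, a contradiction.
\<close>

subsection \<open>Paths and cycles as lists\<close>

lemma path_edges_Nil [simp]: "path_edges [] = {}"
  and path_edges_single [simp]: "path_edges [x] = {}"
  by (auto simp: path_edges_def)

lemma path_edges_Cons2 [simp]: "path_edges (x # y # zs) = insert {x, y} (path_edges (y # zs))"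
proof -
  have "{i. Suc i < length (x # y # zs)} = insert 0 (Suc ` {i. Suc i < length (y # zs)})"
    by (auto simp: image_iff) (metis Suc_less_eq old.nat.exhaust)
  moreover have "path_edges xs = (\<lambda>i. {xs ! i, xs ! Suc i}) ` {i. Suc i < length xs}" for xs :: "'a list"
    by (auto simp: path_edges_def)
  ultimately show ?thesis by (simp add: image_image)
qed

lemma path_edges_append:
  "path_edges (xs @ y # ys) = path_edges (xs @ [y]) \<union> path_edges (y # ys)"
proof (induction xs)
  case Nil
  then show ?case by simp
next
  case (Cons x xs)
  then show ?case by (cases xs) auto
qed

lemma path_edges_snoc: "xs \<noteq> [] \<Longrightarrow> path_edges (xs @ [y]) = insert {last xs, y} (path_edges xs)"
  by (induction xs rule: induct_list012) auto

lemma path_edges_rev [simp]: "path_edges (rev xs) = path_edges xs"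
proof (induction xs rule: induct_list012)
  case (3 x y zs)
  then show ?case
    using path_edges_append [of "rev zs" y "[x]"] by (auto simp: insert_commute)
qed auto

lemma path_edges_subset: "e \<in> path_edges xs \<Longrightarrow> e \<subseteq> set xs"
  by (auto simp: path_edges_def)

lemma Union_path_edges: "2 \<le> length xs \<Longrightarrow> \<Union>(path_edges xs) = set xs"
proof (induction xs rule: induct_list012)
  case (3 x y zs)
  then show ?case by (cases zs) auto
qed auto

lemma finite_path_edges [simp]: "finite (path_edges xs)"
  by (induction xs rule: induct_list012) auto

lemma card_path_edges: "distinct xs \<Longrightarrow> card (path_edges xs) = length xs - 1"
proof (induction xs rule: induct_list012)
  case (3 x y zs)
  then have "{x, y} \<notin> path_edges (y # zs)"
    using path_edges_subset by fastforce
  with 3 show ?case by simp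
qed auto

text \<open>The closing edge is added unconditionally, so this is the edge set of a cycle only for
  lists of length at least 3, as \<open>is_cycle\<close> demands.\<close>

definition cycle_edges :: "'a list \<Rightarrow> 'a set set" where
  "cycle_edges c = insert {last c, hd c} (path_edges c)"

lemma is_cycle_iff:
  "is_cycle G c \<longleftrightarrow> 3 \<le> length c \<and> distinct c \<and> set c \<subseteq> verts G \<and> cycle_edges c \<subseteq> edges G"
  by (auto simp: is_cycle_def is_path_def cycle_edges_def)

text \<open>Two vertices cut a cycle into two arcs. The second arc runs against the list, hence
  \<open>rev b\<close>; both then lead from \<open>x\<close> to \<open>y\<close>, the form needed
  for theta graphs.\<close>

lemma cycle_edges_two_paths:
  "cycle_edges (x # a @ y # b) = path_edges (x # a @ [y]) \<union> path_edges (x # rev b @ [y])"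
proof -
  have "path_edges (x # rev b @ [y]) = path_edges (rev (x # rev b @ [y]))"
    by (rule path_edges_rev [symmetric])
  also have "\<dots> = insert {last (y # b), x} (path_edges (y # b))"
    using path_edges_snoc [of "y # b" x] by simp
  finally show ?thesis
    using path_edges_append [of "x # a" y b] by (auto simp: cycle_edges_def)
qed

text \<open>Cutting at the heads of the two blocks gives the same two arcs in either order, up to
  reversal.\<close>

lemma cycle_edges_rotate: "cycle_edges (xs @ ys) = cycle_edges (ys @ xs)"
proof (cases "xs = [] \<or> ys = []")
  case False
  then obtain x a y b where "xs = x # a" "ys = y # b"
    by (meson neq_Nil_conv)
  then show ?thesis
    using cycle_edges_two_paths [of x a y b] cycle_edges_two_paths [of y b x a]
      path_edges_rev [of "x # a @ [y]"] path_edges_rev [of "y # b @ [x]"] by auto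
qed auto

lemma Union_cycle_edges: "c \<noteq> [] \<Longrightarrow> \<Union>(cycle_edges c) = set c"
  by (induction c rule: induct_list012)
    (auto simp: cycle_edges_def Union_path_edges dest: path_edges_subset)

lemma finite_cycle_edges [simp]: "finite (cycle_edges c)"
  by (simp add: cycle_edges_def)

lemma card_cycle_edges:
  assumes "distinct c" "3 \<le> length c"
  shows "card (cycle_edges c) = length c"
proof -
  obtain x y c' where c: "c = x # y # c'" "c' \<noteq> []"
    using assms by (metis One_nat_def Suc_1 Suc_le_length_iff length_0_conv not_less_eq_eq numeral_3_eq_3 zero_le)
  \<comment> \<open>With at least three vertices the first and the last are not consecutive, so the
    closing edge is new.\<close>
  have "{last c, x} \<notin> path_edges c"
  proof -
    have "last c \<in> set c'" using c by simp
    then have "{last c, x} \<noteq> {x, y}" using assms c by (auto simp: doubleton_eq_iff)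
    moreover have "{last c, x} \<notin> path_edges (y # c')"
      using path_edges_subset [of "{last c, x}" "y # c'"] assms c by auto
    ultimately show ?thesis using c by simp
  qed
  then show ?thesis
    using card_path_edges [OF assms(1)] assms(2) c(1) by (simp add: cycle_edges_def)
qed

text \<open>Rotating the list to start at \<open>x\<close> lets \<open>y\<close> cut it into the two
  arcs.\<close>

lemma cycle_split:
  assumes c: "distinct c" "3 \<le> length c" and xy: "x \<in> set c" "y \<in> set c" "x \<noteq> y"
  obtains a b where "distinct (x # a @ y # b)" "set (x # a @ y # b) = set c"
    "length (x # a @ y # b) = length c"
    "cycle_edges c = path_edges (x # a @ [y]) \<union> path_edges (x # b @ [y])"
    "path_edges (x # a @ [y]) \<inter> path_edges (x # b @ [y]) = {}"
proof -
  obtain p q where pq: "c = p @ x # q"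
    using xy(1) by (meson split_list)
  then have "y \<in> set (q @ p)" using xy by auto
  then obtain a b where ab: "q @ p = a @ y # b" by (meson split_list)
  have eq: "x # a @ y # b = (x # q) @ p" using ab by simp
  have ce: "cycle_edges c = path_edges (x # a @ [y]) \<union> path_edges (x # rev b @ [y])"
    unfolding cycle_edges_two_paths [symmetric] unfolding eq pq by (rule cycle_edges_rotate)
  have d: "distinct (x # a @ y # b)" "set (x # a @ y # b) = set c"
      "length (x # a @ y # b) = length c"
    unfolding eq using c(1) pq by auto
  \<comment> \<open>Edge-disjointness by counting: the sizes of the arcs add up to the number of
    edges of the cycle, so inclusion-exclusion leaves no common edge.\<close>
  have "card (path_edges (x # a @ [y])) = length a + 1" "card (path_edges (x # rev b @ [y])) = length b + 1"
    using d(1) by (subst card_path_edges; auto)+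
  then have "card (path_edges (x # a @ [y])) + card (path_edges (x # rev b @ [y])) = card (cycle_edges c)"
    using card_cycle_edges [OF c] d(3) by simp
  then have "path_edges (x # a @ [y]) \<inter> path_edges (x # rev b @ [y]) = {}"
    using card_Un_Int [of "path_edges (x # a @ [y])" "path_edges (x # rev b @ [y])"] unfolding ce by simp
  then show thesis
    using that [of a "rev b"] d ce by auto
qed

subsection \<open>Biconnected graphs and ears\<close>

text \<open>Absence of separations of order at most one, disconnected graphs included. When this
  fails, the edges are covered by two smaller vertex sets with at most one common vertex, which is
  what the induction for the edge bound consumes.\<close>

definition biconnected :: "'a ugraph \<Rightarrow> bool" where
  "biconnected G \<longleftrightarrow> (\<forall>A B. A \<union> B = verts G \<and> A \<noteq> verts G \<and> B \<noteq> verts G \<and>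
     (\<forall>e\<in>edges G. e \<subseteq> A \<or> e \<subseteq> B) \<longrightarrow> 2 \<le> card (A \<inter> B))"

text \<open>A walk is kept a path while it grows: stepping onto an old vertex cuts the path back to
  that vertex. The bound on \<open>set p\<close> confines the path to what is reachable from
  \<open>a\<close>.\<close>

lemma rtrancl_path:
  assumes "(a, b) \<in> R\<^sup>*"
  shows "\<exists>p. p \<noteq> [] \<and> distinct p \<and> hd p = a \<and> last p = b \<and> path_edges p \<subseteq> {{u, v} |u v. (u, v) \<in> R} \<and>
    set p \<subseteq> {w. (a, w) \<in> R\<^sup>*}"
  using assms
proof (induction rule: rtrancl_induct)
  case base
  show ?case by (rule exI [of _ "[a]"]) auto
next
  case (step b c)
  then obtain p where p: "p \<noteq> []" "distinct p" "hd p = a" "last p = b"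
      "path_edges p \<subseteq> {{u, v} |u v. (u, v) \<in> R}" "set p \<subseteq> {w. (a, w) \<in> R\<^sup>*}"
    by blast
  show ?case
  proof (cases "c \<in> set p")
    case True
    then obtain q r where "p = q @ c # r" by (meson split_list)
    then show ?thesis
      using p path_edges_append [of q c r]
      by (intro exI [of _ "q @ [c]"]) (auto simp: hd_append split: if_splits)
  next
    case False
    then show ?thesis
      using p step path_edges_snoc [OF p(1), of c]
      by (intro exI [of _ "p @ [c]"]) (auto intro: rtrancl_into_rtrancl)
  qed
qed

text \<open>Let \<open>W\<close> be the component of \<open>z\<close> after deletion of
  \<open>U\<close>, and \<open>N\<close> its neighbours in \<open>U\<close>. If \<open>N\<close> had
  at most one element, \<open>W \<union> N\<close> and the complement of \<open>W\<close> would be a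
  separation of order at most one. So \<open>W\<close> attaches at two vertices, joined by a path
  through \<open>W\<close>. The relation \<open>R\<close> is exposed so that the position of the ear
  relative to a cycle can be traced from \<open>z\<close>.\<close>

lemma ear_exists:
  assumes G: "simple_graph G" "biconnected G"
    and U: "U \<subseteq> verts G" "2 \<le> card U" and z: "z \<in> verts G" "z \<notin> U"
    and R: "R = {(a, b). {a, b} \<in> edges G \<and> a \<notin> U \<and> b \<notin> U}"
  obtains x y p where "x \<in> U" "y \<in> U" "x \<noteq> y" "p \<noteq> []" "distinct p" "set p \<subseteq> {w. (z, w) \<in> R\<^sup>*}"
    "set p \<inter> U = {}" "path_edges (x # p @ [y]) \<subseteq> edges G"
proof -
  define W where "W = {w. (z, w) \<in> R\<^sup>*}"
  define N where "N = {u \<in> U. \<exists>w\<in>W. {u, w} \<in> edges G}"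
  have fin: "finite (verts G)" and ed: "\<And>e. e \<in> edges G \<Longrightarrow> e \<subseteq> verts G \<and> card e = 2"
    using G(1) by (auto simp: simple_graph_def)
  have W: "w \<in> verts G \<and> w \<notin> U" if "w \<in> W" for w
  proof -
    have "(z, w) \<in> R\<^sup>*" using that by (simp add: W_def)
    then show ?thesis by (induction rule: rtrancl_induct) (use z ed in \<open>auto simp: R\<close>)
  qed
  have zW: "z \<in> W" by (simp add: W_def)
  have step: "b \<in> W" if "a \<in> W" "{a, b} \<in> edges G" "b \<notin> U" for a b
  proof -
    have "(a, b) \<in> R" using that W by (simp add: R)
    then show ?thesis using that(1) by (auto simp: W_def intro: rtrancl_into_rtrancl)
  qed
  have "2 \<le> card N"
  proof (rule ccontr)
    assume N: "\<not> 2 \<le> card N"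
    have NU: "N \<subseteq> U" by (auto simp: N_def)
    then have "N \<noteq> U" using N U(2) by auto
    then obtain u where u: "u \<in> U" "u \<notin> N" using NU by blast
    have "W \<union> N \<noteq> verts G" using u U(1) W by blast
    moreover have "verts G - W \<noteq> verts G" using zW W by blast
    moreover have "e \<subseteq> W \<union> N \<or> e \<subseteq> verts G - W" if e: "e \<in> edges G" for e
    proof (rule ccontr)
      assume h: "\<not> ?thesis"
      then obtain a where a: "a \<in> e" "a \<in> W" using ed e by blast
      obtain b where b: "b \<in> e" "b \<notin> W" "b \<notin> N" using h by blast
      have "card e = 2" using ed e by blast
      then have "e = {a, b}" using a b by (auto simp: card_2_iff)
      then show False using a b e step [of a b] by (auto simp: N_def insert_commute)
    qed
    moreover have "(W \<union> N) \<union> (verts G - W) = verts G" "(W \<union> N) \<inter> (verts G - W) = N"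
      using W NU U(1) by auto
    ultimately show False using G(2) N unfolding biconnected_def by metis
  qed
  then obtain N' where "N' \<subseteq> N" "card N' = 2" by (meson obtain_subset_with_card_n)
  then obtain x y where xy: "x \<in> N" "y \<in> N" "x \<noteq> y" by (auto simp: card_2_iff)
  then obtain a b where ab: "a \<in> W" "b \<in> W" "{x, a} \<in> edges G" "{y, b} \<in> edges G"
    by (auto simp: N_def)
  \<comment> \<open>Symmetry turns reachability of \<open>a\<close> and \<open>b\<close> from
    \<open>z\<close> into reachability of \<open>b\<close> from \<open>a\<close>.\<close>
  have "sym R" by (auto simp: sym_def R insert_commute)
  then have "(a, b) \<in> R\<^sup>*"
    using ab(1,2) by (auto simp: W_def intro: rtrancl_trans dest: symD [OF sym_rtrancl])
  from rtrancl_path [OF this] obtain p where p: "p \<noteq> []" "distinct p" "hd p = a" "last p = b"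
      "path_edges p \<subseteq> {{u, v} |u v. (u, v) \<in> R}" "set p \<subseteq> {w. (a, w) \<in> R\<^sup>*}"
    by blast
  have pW: "set p \<subseteq> W" using p(6) ab(1) by (auto simp: W_def)
  obtain p' where p': "p = a # p'" using p(1,3) by (cases p) auto
  have "path_edges (x # p @ [y]) = insert {x, a} (insert {b, y} (path_edges p))"
    using path_edges_snoc [OF p(1), of y] p(4) p' by simp
  also have "\<dots> \<subseteq> edges G" using ab p(5) by (auto simp: R insert_commute)
  finally have "path_edges (x # p @ [y]) \<subseteq> edges G" .
  then show thesis
    using that [of x y p] xy p(1,2) pW W by (auto simp: N_def W_def)
qed

text \<open>On a longest path all neighbours of the first vertex lie on the path. Two edges at this
  vertex give a neighbour beyond the second vertex, and the edge to it closes a cycle.\<close>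

lemma cycle_exists:
  assumes G: "simple_graph G" "verts G \<noteq> {}"
    and deg: "\<And>v. v \<in> verts G \<Longrightarrow> 2 \<le> card {e \<in> edges G. v \<in> e}"
  shows "\<exists>c. is_cycle G c"
proof -
  have fin: "finite (verts G)" and ed: "\<And>e. e \<in> edges G \<Longrightarrow> e \<subseteq> verts G \<and> card e = 2"
    using G(1) by (auto simp: simple_graph_def)
  obtain v where v: "v \<in> verts G" using G(2) by blast
  have pv: "is_path G [v]" using v by (simp add: is_path_def)
  have bd: "\<forall>xs. is_path G xs \<longrightarrow> length xs < Suc (card (verts G))"
    using fin by (auto simp: is_path_def less_Suc_eq_le intro: card_mono simp flip: distinct_card)
  obtain xs where xs: "is_path G xs" and max: "\<And>ys. is_path G ys \<Longrightarrow> length ys \<le> length xs"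
    using ex_has_greatest_nat [of "is_path G" "[v]" length, OF pv bd] by auto
  then obtain x zs where x: "xs = x # zs" by (cases xs) (auto simp: is_path_def)
  then have xV: "x \<in> verts G" using xs by (auto simp: is_path_def)
  obtain S where "S \<subseteq> {e \<in> edges G. x \<in> e}" "card S = 2"
    using deg [OF xV] by (meson obtain_subset_with_card_n)
  then obtain e f where ef: "e \<in> edges G" "x \<in> e" "f \<in> edges G" "x \<in> f" "e \<noteq> f"
    by (auto simp: card_2_iff)
  have other: "\<exists>y. g = {x, y} \<and> y \<in> set zs" if g: "g \<in> edges G" "x \<in> g" for g
  proof -
    obtain y where y: "g = {x, y}" "y \<noteq> x" using ed [OF g(1)] g(2) by (auto simp: card_2_iff)
    have "y \<in> set xs"
    proof (rule ccontr)
      assume "y \<notin> set xs"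
      then have "is_path G (y # xs)"
        using xs y g ed [OF g(1)] by (auto simp: is_path_def x insert_commute)
      then show False using max by fastforce
    qed
    then show ?thesis using y x by auto
  qed
  obtain y where y: "{x, y} \<in> edges G" "y \<in> set zs" "y \<noteq> hd zs"
    using other [of e] other [of f] ef by metis
  obtain a b where ab: "zs = a @ y # b" using y(2) by (meson split_list)
  have "a \<noteq> []" using y(3) ab by auto
  then have "is_cycle G (x # a @ [y])"
    using xs y(1) path_edges_append [of "x # a" y b]
    by (auto simp: is_cycle_def is_path_def x ab insert_commute Suc_le_eq)
  then show ?thesis by blast
qed

subsection \<open>Plane topology\<close>

lemma connected_subset_inside:
  assumes "connected T" "T \<inter> S = {}" "x \<in> T" "x \<in> inside S"
  shows "T \<subseteq> inside S"
proof
  fix y assume "y \<in> T"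
  then have "connected_component (- S) x y"
    using assms by (auto simp: connected_component_def)
  then show "y \<in> inside S" using assms(4) inside_same_component by blast
qed

text \<open>By invariance of dimension: the inverse of the parametrization would map a nonempty open
  subset of the plane continuously and injectively into the real line.\<close>

lemma interior_arc_empty:
  fixes g :: "real \<Rightarrow> complex"
  assumes "arc g"
  shows "interior (path_image g) = {}"
proof (rule ccontr)
  assume ne: "interior (path_image g) \<noteq> {}"
  obtain h where h: "homeomorphism {0..1} (path_image g) g h"
    using homeomorphism_arc [OF assms] by metis
  have "dim (UNIV :: complex set) \<le> dim (UNIV :: real set)"
  proof (rule invariance_of_dimension_subspaces)
    show "continuous_on (interior (path_image g)) h"
      using h interior_subset by (metis continuous_on_subset homeomorphism_def)
    show "inj_on h (interior (path_image g))"
      using h interior_subset [of "path_image g"]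
      by (intro inj_on_inverseI [of _ g]) (auto simp: homeomorphism_def)
  qed (use ne in \<open>auto simp: subspace_UNIV\<close>)
  then show False by simp
qed

text \<open>The inversion sends its centre \<open>a\<close> to infinity. The image \<open>T\<close>
  of the punctured inside is connected, misses the image of \<open>S\<close>, and is unbounded
  because it contains images of points arbitrarily close to \<open>a\<close>.\<close>

lemma inversion_inside:
  fixes a :: complex
  assumes "compact S" "connected (inside S)" and a: "a \<in> inside S" and z: "z \<in> inside S" "z \<noteq> a"
    and h: "h = (\<lambda>z. inverse (z - a))"
  shows "h z \<in> outside (h ` S)"
proof -
  define T where "T = h ` (inside S - {a})"
  have opn: "open (inside S)" using assms by (simp add: compact_imp_closed open_inside)
  have aS: "a \<notin> S" using a inside_no_overlap [of S] by blast
  have "connected (inside S - {a})"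
    using assms opn by (intro connected_open_delete) auto
  moreover have "continuous_on (inside S - {a}) h" unfolding h by (intro continuous_intros) auto
  ultimately have T: "connected T" unfolding T_def by (rule connected_continuous_image[rotated])
  have Tdj: "T \<subseteq> - h ` S"
    using disjoint_iff [THEN iffD1, OF inside_no_overlap [of S]] aS by (auto simp: T_def h)
  have hz: "h z \<in> T" using z by (auto simp: T_def)
  have "\<not> bounded T"
  proof
    assume "bounded T"
    then obtain B where B: "B > 0" "\<And>x. x \<in> T \<Longrightarrow> norm x \<le> B" by (auto simp: bounded_pos)
    obtain r where r: "r > 0" "ball a r \<subseteq> inside S" using opn a by (meson openE)
    \<comment> \<open>The first bound keeps \<open>a + d\<close> in the ball inside
      \<open>S\<close>; the second makes its image have norm \<open>1 / d\<close>, at least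
      \<open>2 * B\<close>.\<close>
    define d where "d = min (r / 2) (1 / (2 * B))"
    have d: "d > 0" "d < r" "d \<le> 1 / (2 * B)" using r B by (auto simp: d_def)
    have "a + of_real d \<in> inside S - {a}"
      using d r(2) by (auto simp: dist_norm)
    then have "h (a + of_real d) \<in> T" by (auto simp: T_def)
    then have "norm (h (a + of_real d)) \<le> B" by (rule B)
    then have "inverse d \<le> B" using d by (simp add: h norm_inverse)
    moreover have "inverse d \<ge> 2 * B" using d B by (simp add: field_simps)
    ultimately show False using B by simp
  qed
  moreover have "T \<subseteq> connected_component_set (- h ` S) (h z)"
    by (rule connected_component_maximal [OF hz T Tdj])
  ultimately have "\<not> bounded (connected_component_set (- h ` S) (h z))"
    using bounded_subset by blast
  then show ?thesis using hz Tdj by (auto simp: outside_def)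
qed

text \<open>Pull the component \<open>W\<close> of \<open>h z\<close> back along \<open>k\<close>,
  the inverse of the inversion. The point 0, which corresponds to infinity, is removed first; an
  open connected set of the plane stays connected. The preimage remains outside \<open>S\<close>,
  hence misses a ball of radius \<open>r\<close> around \<open>a\<close>, so \<open>W\<close> lies
  in the disc of radius \<open>1 / r\<close>.\<close>

lemma inversion_outside:
  fixes a :: complex
  assumes "compact S" and a: "a \<in> inside S" and z: "z \<in> outside S"
    and h: "h = (\<lambda>z. inverse (z - a))"
  shows "h z \<in> inside (h ` S)"
proof -
  have opn: "open (inside S)" using assms by (simp add: compact_imp_closed open_inside)
  have aS: "a \<notin> S" using a inside_no_overlap [of S] by blast
  have za: "z \<noteq> a" using z a inside_Int_outside [of S] by blast
  have zS: "z \<notin> S" using z outside_no_overlap [of S] by blast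
  obtain r where r: "r > 0" "ball a r \<subseteq> inside S" using opn a by (meson openE)
  have "continuous_on S h" using aS unfolding h by (intro continuous_intros) auto
  then have "compact (h ` S)" using assms(1) by (rule compact_continuous_image)
  then have op: "open (- h ` S)" by (simp add: compact_imp_closed open_Compl)
  define W where "W = connected_component_set (- h ` S) (h z)"
  define k where "k = (\<lambda>w. a + inverse w)"
  have hz: "h z \<in> - h ` S" "h z \<noteq> 0" using zS za aS by (auto simp: h)
  have W: "open W" "connected W" "W \<subseteq> - h ` S" "h z \<in> W"
    using op hz connected_component_subset [of "- h ` S" "h z"] by (auto simp: W_def open_connected_component)
  have cW: "connected (k ` (W - {0}))"
  proof (rule connected_continuous_image)
    show "continuous_on (W - {0}) k" unfolding k_def by (intro continuous_intros) auto
    show "connected (W - {0})" using W by (intro connected_open_delete) auto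
  qed
  have kS: "k ` (W - {0}) \<subseteq> - S"
  proof clarify
    fix w assume w: "w \<in> W" "w \<noteq> 0" "k w \<in> S"
    have "h (k w) = w" by (simp add: h k_def)
    then show False using w W(3) by (metis ComplD image_eqI subsetD)
  qed
  have zk: "z \<in> k ` (W - {0})"
    using W(4) hz(2) by (intro image_eqI [of _ _ "h z"]) (auto simp: k_def h)
  have "k ` (W - {0}) \<subseteq> outside S"
  proof
    fix w assume "w \<in> k ` (W - {0})"
    then have "connected_component (- S) z w" using cW kS zk by (auto simp: connected_component_def)
    then show "w \<in> outside S" using z outside_same_component by blast
  qed
  then have out: "k w \<notin> inside S" if "w \<in> W" "w \<noteq> 0" for w
    using that inside_Int_outside [of S] by blast
  have "W \<subseteq> cball 0 (1 / r)"
  proof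
    fix w assume w: "w \<in> W"
    show "w \<in> cball 0 (1 / r)"
    proof (cases "w = 0")
      case True
      then show ?thesis using r by simp
    next
      case False
      then have "k w \<notin> ball a r" using out w r by blast
      then have "r \<le> norm (inverse w)" by (simp add: k_def dist_norm)
      then have "r \<le> inverse (norm w)" by (simp add: norm_inverse)
      then show ?thesis using False r by (simp add: field_simps)
    qed
  qed
  then have "bounded W" using bounded_cball bounded_subset by blast
  then show ?thesis using hz by (auto simp: inside_def W_def)
qed

text \<open>A drawing is described by arcs, images and intersections, all preserved by a continuous
  injection. The set \<open>T\<close> accommodates the inversion, which is continuous only away from
  its centre.\<close>

lemma plane_drawing_compose:
  assumes G: "plane_drawing G \<phi> \<gamma>" and h: "continuous_on T h" "inj_on h T"
    and T: "\<phi> ` verts G \<subseteq> T" "\<And>e. e \<in> edges G \<Longrightarrow> path_image (\<gamma> e) \<subseteq> T" and V: "\<And>e. e \<in> edges G \<Longrightarrow> e \<subseteq> verts G"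
  shows "plane_drawing G (h \<circ> \<phi>) (\<lambda>e. h \<circ> \<gamma> e)"
  unfolding plane_drawing_def
proof (intro conjI ballI impI)
  show "inj_on (h \<circ> \<phi>) (verts G)"
    using G h T by (auto simp: plane_drawing_def intro: comp_inj_on inj_on_subset)
  fix e assume e: "e \<in> edges G"
  have G': "arc (\<gamma> e)" "{pathstart (\<gamma> e), pathfinish (\<gamma> e)} = \<phi> ` e"
    "path_image (\<gamma> e) \<inter> \<phi> ` verts G = \<phi> ` e"
    using G e by (auto simp: plane_drawing_def)
  show "arc (h \<circ> \<gamma> e)"
    unfolding arc_def
  proof
    show "path (h \<circ> \<gamma> e)"
      using G'(1) h(1) T(2) [OF e] by (auto simp: arc_def intro: path_continuous_image continuous_on_subset)
    show "inj_on (h \<circ> \<gamma> e) {0..1}"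
      using G'(1) h(2) T(2) [OF e] by (auto simp: arc_def path_image_def intro: comp_inj_on inj_on_subset)
  qed
  show "{pathstart (h \<circ> \<gamma> e), pathfinish (h \<circ> \<gamma> e)} = (h \<circ> \<phi>) ` e"
    unfolding pathstart_compose pathfinish_compose image_comp [symmetric] G'(2) [symmetric] by simp
  show "path_image (h \<circ> \<gamma> e) \<inter> (h \<circ> \<phi>) ` verts G = (h \<circ> \<phi>) ` e"
    using inj_on_image_Int [OF h(2) T(2) [OF e] T(1)] G'(3)
    unfolding path_image_compose image_comp [symmetric] by simp
  fix f assume f: "f \<in> edges G" "e \<noteq> f"
  have "path_image (\<gamma> e) \<inter> path_image (\<gamma> f) = \<phi> ` (e \<inter> f)"
    using G e f by (auto simp: plane_drawing_def)
  then show "path_image (h \<circ> \<gamma> e) \<inter> path_image (h \<circ> \<gamma> f) = (h \<circ> \<phi>) ` (e \<inter> f)"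
    using inj_on_image_Int [OF h(2) T(2) [OF e] T(2) [OF f(1)]]
    unfolding path_image_compose image_comp [symmetric] by simp
qed

subsection \<open>Drawings of paths and theta graphs\<close>

locale plane_graph =
  fixes G :: "'a ugraph" and \<phi> :: "'a \<Rightarrow> complex" and \<gamma> :: "'a set \<Rightarrow> real \<Rightarrow> complex"
  assumes simple: "simple_graph G" and drawing: "plane_drawing G \<phi> \<gamma>"
begin

lemma finite_verts: "finite (verts G)"
  using simple by (simp add: simple_graph_def)

lemma edgeD: "e \<in> edges G \<Longrightarrow> e \<subseteq> verts G" "e \<in> edges G \<Longrightarrow> card e = 2"
    "e \<in> edges G \<Longrightarrow> finite e"
  using simple by (auto simp: simple_graph_def intro: card_ge_0_finite)

lemma finite_edges: "finite (edges G)"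
  by (rule finite_subset [of _ "Pow (verts G)"]) (use finite_verts edgeD in auto)

lemma inj: "inj_on \<phi> (verts G)"
  using drawing by (simp add: plane_drawing_def)

lemma edge_arc:
  assumes "e \<in> edges G"
  shows "arc (\<gamma> e)" "{pathstart (\<gamma> e), pathfinish (\<gamma> e)} = \<phi> ` e"
    "path_image (\<gamma> e) \<inter> \<phi> ` verts G = \<phi> ` e"
  using drawing assms by (auto simp: plane_drawing_def)

lemma edge_inter:
  assumes "e \<in> edges G" "f \<in> edges G" "e \<noteq> f"
  shows "path_image (\<gamma> e) \<inter> path_image (\<gamma> f) = \<phi> ` (e \<inter> f)"
  using drawing assms by (auto simp: plane_drawing_def)

definition draw :: "'a set set \<Rightarrow> complex set" where
  "draw F = (\<Union>e\<in>F. path_image (\<gamma> e))"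

text \<open>The drawing together with everything it encloses. For edges of \<open>G\<close> this is
  a closed set, so an edge whose interior points lie in it belongs to it including its ends.\<close>

definition region :: "'a set set \<Rightarrow> complex set" where
  "region F = - outside (draw F)"

lemma region_eq: "region F = draw F \<union> inside (draw F)"
  unfolding region_def
  using inside_Un_outside [of "draw F"] inside_Int_outside [of "draw F"] outside_no_overlap [of "draw F"]
  by blast

lemma draw_Un: "draw (F \<union> F') = draw F \<union> draw F'"
  by (auto simp: draw_def)

lemma vertex_in_edge:
  assumes "e \<in> edges G" "v \<in> verts G"
  shows "\<phi> v \<in> path_image (\<gamma> e) \<longleftrightarrow> v \<in> e"
proof -
  have "\<phi> v \<in> path_image (\<gamma> e) \<longleftrightarrow> \<phi> v \<in> \<phi> ` e"
    using edge_arc(3) [OF assms(1)] assms(2) by blast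
  then show ?thesis
    using inj_on_image_mem_iff [OF inj assms(2) edgeD(1) [OF assms(1)]] by simp
qed

lemma vertex_in_draw:
  assumes "F \<subseteq> edges G" "v \<in> verts G"
  shows "\<phi> v \<in> draw F \<longleftrightarrow> v \<in> \<Union>F"
  using assms vertex_in_edge by (auto simp: draw_def)

lemma draw_inter:
  assumes "F \<subseteq> edges G" "F' \<subseteq> edges G" "F \<inter> F' = {}"
  shows "draw F \<inter> draw F' = \<phi> ` (\<Union>F \<inter> \<Union>F')"
proof -
  have "draw F \<inter> draw F' = (\<Union>e\<in>F. \<Union>f\<in>F'. path_image (\<gamma> e) \<inter> path_image (\<gamma> f))"
    by (auto simp: draw_def)
  also have "\<dots> = (\<Union>e\<in>F. \<Union>f\<in>F'. \<phi> ` (e \<inter> f))"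
    by (intro SUP_cong refl edge_inter) (use assms in auto)
  finally show ?thesis by auto
qed

lemma edge_inter_draw:
  assumes "F \<subseteq> edges G" "e \<in> edges G" "e \<notin> F"
  shows "path_image (\<gamma> e) \<inter> draw F = \<phi> ` (e \<inter> \<Union>F)"
  using draw_inter [of "{e}" F] assms by (simp add: draw_def)

lemma infinite_edge:
  assumes "e \<in> edges G"
  shows "infinite (path_image (\<gamma> e))"
proof -
  have "inj_on (\<gamma> e) {0..1}" using edge_arc(1) [OF assms] by (simp add: arc_def)
  moreover have "infinite {0..1::real}" by simp
  ultimately show ?thesis unfolding path_image_def using finite_imageD by blast
qed

text \<open>An edge not in \<open>F\<close> meets the drawing of \<open>F\<close> in at most its own
  two ends, whereas an arc has infinitely many points.\<close>

lemma edge_subset_draw: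
  assumes "F \<subseteq> edges G" "e \<in> edges G"
  shows "path_image (\<gamma> e) \<subseteq> draw F \<longleftrightarrow> e \<in> F"
proof
  assume "path_image (\<gamma> e) \<subseteq> draw F"
  then have "e \<notin> F \<Longrightarrow> path_image (\<gamma> e) = \<phi> ` (e \<inter> \<Union>F)"
    using edge_inter_draw [OF assms] by auto
  moreover have "finite (\<phi> ` (e \<inter> \<Union>F))" using edgeD(3) [OF assms(2)] by auto
  ultimately show "e \<in> F" using infinite_edge [OF assms(2)] by metis
qed (auto simp: draw_def)

lemma compact_draw: "F \<subseteq> edges G \<Longrightarrow> compact (draw F)"
  unfolding draw_def
  by (rule compact_UN) (use edge_arc(1) finite_edges in \<open>auto intro: finite_subset compact_arc_image\<close>)

lemma closed_region: "F \<subseteq> edges G \<Longrightarrow> closed (region F)"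
  unfolding region_def using compact_draw [of F] open_outside [of "draw F"]
  by (auto intro: compact_imp_closed)

lemma open_edge:
  assumes "e \<in> edges G"
  shows "connected (path_image (\<gamma> e) - \<phi> ` e)" "path_image (\<gamma> e) - \<phi> ` e \<noteq> {}"
proof -
  show "connected (path_image (\<gamma> e) - \<phi> ` e)"
    using connected_simple_path_endless [of "\<gamma> e"] edge_arc [OF assms] arc_imp_simple_path by metis
  show "path_image (\<gamma> e) - \<phi> ` e \<noteq> {}"
    using infinite_edge [OF assms] edgeD(3) [OF assms]
    by (metis Diff_eq_empty_iff finite_imageI finite_subset)
qed

text \<open>The ends of an arc are limits of its interior points.\<close>

lemma edge_subset_closed:
  assumes "e \<in> edges G" "closed T" "path_image (\<gamma> e) - \<phi> ` e \<subseteq> T"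
  shows "path_image (\<gamma> e) \<subseteq> T"
proof -
  have arc: "arc (\<gamma> e)" by (rule edge_arc(1)) fact
  have "\<gamma> e t \<in> path_image (\<gamma> e) - \<phi> ` e" if "t \<in> {0<..<1}" for t
  proof -
    have "inj_on (\<gamma> e) {0..1}" using arc by (simp add: arc_def)
    then have "\<gamma> e t \<noteq> \<gamma> e 0" "\<gamma> e t \<noteq> \<gamma> e 1"
      using that inj_onD [of "\<gamma> e" "{0..1}" t 0] inj_onD [of "\<gamma> e" "{0..1}" t 1] by force+
    then show ?thesis
      using that edge_arc(2) [OF assms(1), symmetric] by (auto simp: path_image_def pathstart_def pathfinish_def)
  qed
  then have "\<gamma> e ` {0<..<1} \<subseteq> T" using assms(3) by blast
  moreover have "continuous_on (closure {0<..<1}) (\<gamma> e)"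
    using arc by (simp add: arc_def path_def)
  ultimately have "\<gamma> e ` closure {0<..<1} \<subseteq> T"
    by (intro image_closure_subset assms(2))
  then show ?thesis by (simp add: path_image_def)
qed

lemma open_edge_disjoint_draw:
  assumes "F \<subseteq> edges G" "e \<in> edges G" "e \<notin> F"
  shows "(path_image (\<gamma> e) - \<phi> ` e) \<inter> draw F = {}"
  using edge_inter_draw [OF assms] by auto

text \<open>The arc of the first edge meets the arc of the remaining path only in the shared vertex,
  so the two can be joined.\<close>

lemma path_arc:
  assumes "2 \<le> length xs" "distinct xs" "path_edges xs \<subseteq> edges G"
  shows "\<exists>g. arc g \<and> pathstart g = \<phi> (hd xs) \<and> pathfinish g = \<phi> (last xs) \<and> path_image g = draw (path_edges xs)"
  using assms
proof (induction xs rule: induct_list012)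
  case (3 x y zs)
  have E: "{x, y} \<in> edges G" using 3 by simp
  have xy: "\<phi> x \<noteq> \<phi> y"
    using inj edgeD(1) [OF E] 3 by (auto dest: inj_onD)
  \<comment> \<open>An edge is an unordered pair, so its arc may run either way and may have to be
    reversed.\<close>
  obtain h where h: "arc h" "pathstart h = \<phi> x" "pathfinish h = \<phi> y" "path_image h = path_image (\<gamma> {x, y})"
  proof (cases "pathstart (\<gamma> {x, y}) = \<phi> x")
    case True
    then have "pathfinish (\<gamma> {x, y}) = \<phi> y"
      using edge_arc(2) [OF E] xy by (auto simp: doubleton_eq_iff)
    then show ?thesis using that edge_arc(1) [OF E] True by blast
  next
    case False
    then have "pathstart (\<gamma> {x, y}) = \<phi> y" "pathfinish (\<gamma> {x, y}) = \<phi> x"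
      using edge_arc(2) [OF E] xy by (auto simp: doubleton_eq_iff)
    then show ?thesis
      using that [of "reversepath (\<gamma> {x, y})"] edge_arc(1) [OF E] by (simp add: arc_reversepath)
  qed
  show ?case
  proof (cases "zs = []")
    case True
    then show ?thesis using h by (auto simp: draw_def)
  next
    case False
    then have len: "2 \<le> length (y # zs)" by (cases zs) auto
    then obtain g where g: "arc g" "pathstart g = \<phi> y" "pathfinish g = \<phi> (last (y # zs))"
        "path_image g = draw (path_edges (y # zs))"
      using 3 by fastforce
    have "{x, y} \<notin> path_edges (y # zs)"
      using path_edges_subset 3(4) by fastforce
    then have "path_image h \<inter> path_image g = \<phi> ` ({x, y} \<inter> \<Union>(path_edges (y # zs)))"
      using h g edge_inter_draw [of "path_edges (y # zs)" "{x, y}"] 3 E by simp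
    also have "\<dots> = {\<phi> y}" using Union_path_edges [OF len] 3 by auto
    finally have int: "path_image h \<inter> path_image g = {\<phi> y}" .
    then have "arc (h +++ g)" using h g by (intro arc_join) auto
    moreover have "path_image (h +++ g) = draw (path_edges (x # y # zs))"
      using h g by (subst path_image_join) (auto simp: draw_def)
    ultimately show ?thesis using h g False by (intro exI [of _ "h +++ g"]) auto
  qed
qed auto

text \<open>This is the theta-curve theorem for three paths from \<open>x\<close> to
  \<open>y\<close>, the third of which enters the inside of the cycle formed by the other two.
  Edge-disjointness is required besides vertex-disjointness because paths without inner vertices
  could all be the edge \<open>xy\<close>.\<close>

lemma theta:
  assumes d: "distinct (x # a @ [y])" "distinct (x # b @ [y])" "distinct (x # p @ [y])"
    and A: "A = path_edges (x # a @ [y])" "A \<subseteq> edges G"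
    and B: "B = path_edges (x # b @ [y])" "B \<subseteq> edges G"
    and P: "P = path_edges (x # p @ [y])" "P \<subseteq> edges G"
    and dis: "set a \<inter> set b = {}" "set a \<inter> set p = {}" "set b \<inter> set p = {}"
    and disE: "A \<inter> B = {}" "A \<inter> P = {}" "B \<inter> P = {}"
    and ne: "draw P \<inter> inside (draw (A \<union> B)) \<noteq> {}"
  shows "inside (draw (A \<union> P)) \<inter> inside (draw (B \<union> P)) = {}"
    and "inside (draw (A \<union> P)) \<union> inside (draw (B \<union> P)) \<union> (draw P - {\<phi> x, \<phi> y}) = inside (draw (A \<union> B))"
proof -
  have U: "\<Union>A = set (x # a @ [y])" "\<Union>B = set (x # b @ [y])" "\<Union>P = set (x # p @ [y])"
    unfolding A B P by (rule Union_path_edges; simp)+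
  have V: "x \<in> verts G" "y \<in> verts G" using U A edgeD(1) by (fastforce simp: set_eq_iff)+
  have ab: "\<phi> x \<noteq> \<phi> y" using V d(1) inj by (auto dest: inj_onD)
  have disj: "x \<notin> set a" "x \<notin> set b" "x \<notin> set p" "y \<notin> set a" "y \<notin> set b" "y \<notin> set p"
    using d by auto
  have I: "draw A \<inter> draw B = {\<phi> x, \<phi> y}" "draw A \<inter> draw P = {\<phi> x, \<phi> y}" "draw B \<inter> draw P = {\<phi> x, \<phi> y}"
    using draw_inter [OF A(2) B(2) disE(1)] draw_inter [OF A(2) P(2) disE(2)] draw_inter [OF B(2) P(2) disE(3)]
      dis disj unfolding U by auto
  obtain g1 where g1: "arc g1" "pathstart g1 = \<phi> x" "pathfinish g1 = \<phi> y" "path_image g1 = draw A"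
    using path_arc [of "x # a @ [y]"] d A by auto
  obtain g2 where g2: "arc g2" "pathstart g2 = \<phi> x" "pathfinish g2 = \<phi> y" "path_image g2 = draw B"
    using path_arc [of "x # b @ [y]"] d B by auto
  obtain g where g: "arc g" "pathstart g = \<phi> x" "pathfinish g = \<phi> y" "path_image g = draw P"
    using path_arc [of "x # p @ [y]"] d P by auto
  show "inside (draw (A \<union> P)) \<inter> inside (draw (B \<union> P)) = {}"
    "inside (draw (A \<union> P)) \<union> inside (draw (B \<union> P)) \<union> (draw P - {\<phi> x, \<phi> y}) = inside (draw (A \<union> B))"
    using split_inside_simple_closed_curve [of g1 "\<phi> x" "\<phi> y" g2 g] g1 g2 g I ne ab
    by (auto simp: arc_imp_simple_path draw_Un)
qed

text \<open>Passage from insides to closed regions. Each smaller inside lies in the large one and so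
  avoids the opposite arc; the two closed regions therefore share only the separating arc.\<close>

lemma theta_regions:
  assumes AB: "draw A \<inter> draw B \<subseteq> draw P"
    and 1: "inside (draw (A \<union> P)) \<inter> inside (draw (B \<union> P)) = {}"
    and 2: "inside (draw (A \<union> P)) \<union> inside (draw (B \<union> P)) \<union> (draw P - {u, v}) = inside (draw (A \<union> B))"
    and uv: "{u, v} \<subseteq> draw A"
  shows "region (A \<union> B) = region (A \<union> P) \<union> region (B \<union> P)"
    and "region (A \<union> P) \<inter> region (B \<union> P) = draw P"
proof -
  have n: "inside (draw (A \<union> P)) \<inter> draw (A \<union> P) = {}" "inside (draw (B \<union> P)) \<inter> draw (B \<union> P) = {}"
     "inside (draw (A \<union> B)) \<inter> draw (A \<union> B) = {}"
    by (auto simp: inside_no_overlap)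
  show "region (A \<union> B) = region (A \<union> P) \<union> region (B \<union> P)"
    unfolding region_eq using 2 uv by (auto simp: draw_Un)
  have "inside (draw (A \<union> P)) \<inter> draw (B \<union> P) = {}" "inside (draw (B \<union> P)) \<inter> draw (A \<union> P) = {}"
    using 2 n unfolding draw_Un by fast+
  then show "region (A \<union> P) \<inter> region (B \<union> P) = draw P"
    unfolding region_eq using 1 AB unfolding draw_Un by fast
qed

end

subsection \<open>Counting inside a cycle\<close>

context plane_graph
begin

definition edges_in :: "'a set set \<Rightarrow> 'a set set" where
  "edges_in F = {e \<in> edges G. path_image (\<gamma> e) \<subseteq> region F}"

definition verts_in :: "'a set set \<Rightarrow> 'a set" where
  "verts_in F = {v \<in> verts G. \<phi> v \<in> region F}"

lemma finite_edges_in: "finite (edges_in F)" and finite_verts_in: "finite (verts_in F)"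
  using finite_edges finite_verts by (auto simp: edges_in_def verts_in_def)

lemma draw_subset_region: "draw F \<subseteq> region F"
  by (auto simp: region_eq)

lemma edges_in_superset: "F \<subseteq> edges G \<Longrightarrow> F \<subseteq> edges_in F"
  using draw_subset_region [of F] by (auto simp: edges_in_def draw_def)

lemma verts_in_superset: "F \<subseteq> edges G \<Longrightarrow> \<Union>F \<subseteq> verts_in F"
  using draw_subset_region [of F] vertex_in_draw [of F] edgeD(1) unfolding verts_in_def by blast

text \<open>Something inside the cycle but not on it yields either a chord, which is an ear with
  \<open>p = []\<close>, or a vertex \<open>z\<close> off the cycle. In the second case the ear runs
  through vertices reachable from \<open>z\<close> without touching the cycle, and these are all
  inside.\<close>

lemma inner_ear:
  assumes "biconnected G" and c: "is_cycle G c"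
    and ne: "edges_in (cycle_edges c) \<noteq> cycle_edges c \<or> verts_in (cycle_edges c) \<noteq> set c"
  obtains x y p where "x \<in> set c" "y \<in> set c" "x \<noteq> y" "distinct p" "set p \<inter> set c = {}"
    "path_edges (x # p @ [y]) \<subseteq> edges G" "path_edges (x # p @ [y]) \<inter> cycle_edges c = {}"
    "draw (path_edges (x # p @ [y])) \<inter> inside (draw (cycle_edges c)) \<noteq> {}"
proof -
  let ?C = "cycle_edges c"
  have CE: "?C \<subseteq> edges G" and cV: "set c \<subseteq> verts G" and len: "3 \<le> length c" and dc: "distinct c"
    using c by (auto simp: is_cycle_iff)
  have UC: "\<Union>?C = set c" using len by (intro Union_cycle_edges) auto
  consider (chord) e where "e \<in> edges_in ?C" "e \<notin> ?C" "e \<subseteq> set c"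
    | (vertex) z where "z \<in> verts_in ?C" "z \<notin> set c"
  proof -
    have "\<exists>z. z \<in> verts_in ?C \<and> z \<notin> set c" if asm: "e \<in> edges_in ?C" "\<not> e \<subseteq> set c" for e
    proof -
      have e: "e \<in> edges G" "path_image (\<gamma> e) \<subseteq> region ?C" using asm by (auto simp: edges_in_def)
      obtain z where z: "z \<in> e" "z \<notin> set c" using asm(2) by blast
      then have "z \<in> verts G" "\<phi> z \<in> path_image (\<gamma> e)" using e vertex_in_edge edgeD(1) by blast+
      then show ?thesis using e z by (auto simp: verts_in_def)
    qed
    moreover have "(\<exists>e. e \<in> edges_in ?C \<and> e \<notin> ?C) \<or> (\<exists>z. z \<in> verts_in ?C \<and> z \<notin> set c)"
      using ne edges_in_superset [OF CE] verts_in_superset [OF CE] unfolding UC by blast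
    ultimately show thesis using that by metis
  qed
  then show thesis
  proof cases
    case chord
    have e: "e \<in> edges G" "path_image (\<gamma> e) \<subseteq> region ?C" using chord by (auto simp: edges_in_def)
    obtain x y where xy: "e = {x, y}" "x \<noteq> y" using edgeD(2) [OF e(1)] by (auto simp: card_2_iff)
    have "path_image (\<gamma> e) \<inter> inside (draw ?C) \<noteq> {}"
      using open_edge(2) [OF e(1)] open_edge_disjoint_draw [OF CE e(1) chord(2)] e(2)
      unfolding region_eq by blast
    then show thesis
      using that [of x y "[]"] chord xy e by (auto simp: draw_def)
  next
    case vertex
    define R where "R = {(a, b). {a, b} \<in> edges G \<and> a \<notin> set c \<and> b \<notin> set c}"
    have z: "z \<in> verts G" "\<phi> z \<in> region ?C" using vertex by (auto simp: verts_in_def)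
    have zin: "\<phi> z \<in> inside (draw ?C)"
      using z vertex_in_draw [OF CE z(1)] vertex(2) UC by (auto simp: region_eq)
    \<comment> \<open>An edge with no end on the cycle is drawn disjoint from the curve and hence
      stays on one side of it.\<close>
    have reach: "\<phi> w \<in> inside (draw ?C)" if "(z, w) \<in> R\<^sup>*" for w
      using that
    proof (induction rule: rtrancl_induct)
      case base
      show ?case by (fact zin)
    next
      case (step a b)
      then have ab: "{a, b} \<in> edges G" "a \<notin> set c" "b \<notin> set c" by (auto simp: R_def)
      then have "{a, b} \<notin> ?C" using UC by blast
      then have "path_image (\<gamma> {a, b}) \<inter> draw ?C = {}"
        using edge_inter_draw [OF CE ab(1)] ab UC by auto
      moreover have "\<phi> a \<in> path_image (\<gamma> {a, b})" "\<phi> b \<in> path_image (\<gamma> {a, b})"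
        using vertex_in_edge [OF ab(1)] edgeD(1) [OF ab(1)] by auto
      moreover have "connected (path_image (\<gamma> {a, b}))"
        using edge_arc(1) [OF ab(1)] by (simp add: arc_imp_path connected_path_image)
      ultimately show ?case using connected_subset_inside step.IH by blast
    qed
    have "2 \<le> card (set c)" using distinct_card [OF dc] len by simp
    then obtain x y p where ear: "x \<in> set c" "y \<in> set c" "x \<noteq> y" "p \<noteq> []" "distinct p"
        "set p \<subseteq> {w. (z, w) \<in> R\<^sup>*}" "set p \<inter> set c = {}" "path_edges (x # p @ [y]) \<subseteq> edges G"
      using ear_exists [OF simple assms(1) cV _ z(1) vertex(2) R_def] by metis
    have UP: "\<Union>(path_edges (x # p @ [y])) = set (x # p @ [y])" by (rule Union_path_edges) simp
    have "hd p \<in> set p" using ear(4) by simp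
    moreover have "hd p \<in> verts G"
      using calculation UP ear(8) edgeD(1) by (fastforce simp: set_eq_iff)
    ultimately have "\<phi> (hd p) \<in> draw (path_edges (x # p @ [y])) \<inter> inside (draw ?C)"
      using vertex_in_draw [OF ear(8)] UP reach ear(6) by auto
    \<comment> \<open>Every edge of the ear contains a vertex of \<open>p\<close>, and these are off
      the cycle.\<close>
    moreover have "e \<notin> ?C" if eP: "e \<in> path_edges (x # p @ [y])" for e
    proof
      assume "e \<in> ?C"
      then have ec: "e \<subseteq> set c" using UC by blast
      obtain q p' where p: "p = q # p'" using ear(4) by (cases p) auto
      have "path_edges (x # p @ [y]) = insert {x, q} (insert {last p, y} (path_edges p))"
        using path_edges_snoc [OF ear(4), of y] p by simp
      then consider "e = {x, q}" | "e = {last p, y}" | "e \<in> path_edges p"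
        using eP by auto
      then have "e \<inter> set p \<noteq> {}"
      proof cases
        case 3
        then have "e \<subseteq> set p" "e \<noteq> {}"
          using path_edges_subset by (auto simp: path_edges_def)
        then show ?thesis by blast
      qed (use p ear(4) last_in_set [OF ear(4)] in auto)
      then show False using ec ear(7) by blast
    qed
    ultimately show thesis using that [of x y p] ear by blast
  qed
qed

text \<open>The ear cuts the region into two that share only the ear itself, so vertices and edges
  are distributed over both sides with exactly those of the ear counted twice.\<close>

lemma ear_split:
  assumes c: "distinct (x # a @ y # b)" and p: "distinct p" "set p \<inter> set (x # a @ y # b) = {}"
    and A: "A = path_edges (x # a @ [y])" "A \<subseteq> edges G"
    and B: "B = path_edges (x # b @ [y])" "B \<subseteq> edges G"
    and P: "P = path_edges (x # p @ [y])" "P \<subseteq> edges G"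
    and disE: "A \<inter> B = {}" "A \<inter> P = {}" "B \<inter> P = {}"
    and ne: "draw P \<inter> inside (draw (A \<union> B)) \<noteq> {}"
  shows "verts_in (A \<union> B) = verts_in (A \<union> P) \<union> verts_in (B \<union> P)"
    and "verts_in (A \<union> P) \<inter> verts_in (B \<union> P) = set (x # p @ [y])"
    and "edges_in (A \<union> B) = edges_in (A \<union> P) \<union> edges_in (B \<union> P)"
    and "edges_in (A \<union> P) \<inter> edges_in (B \<union> P) = P"
proof -
  have U: "\<Union>A = set (x # a @ [y])" "\<Union>B = set (x # b @ [y])" "\<Union>P = set (x # p @ [y])"
    unfolding A B P by (rule Union_path_edges; simp)+
  have xyV: "x \<in> verts G" "y \<in> verts G" using U(1) A(2) edgeD(1) by (fastforce simp: set_eq_iff)+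
  have xy: "x \<noteq> y" "distinct (x # a @ [y])" "distinct (x # b @ [y])" "distinct (x # p @ [y])"
     "set a \<inter> set b = {}" "set a \<inter> set p = {}" "set b \<inter> set p = {}"
    using c p by auto
  note th = theta [OF xy(2-4) A B P xy(5-7) disE ne]
  have "draw A \<inter> draw B \<subseteq> draw P"
  proof -
    have "draw A \<inter> draw B = \<phi> ` {x, y}"
      using draw_inter [OF A(2) B(2) disE(1)] U c by auto
    also have "\<dots> \<subseteq> draw P" using vertex_in_draw [OF P(2)] xyV U by auto
    finally show ?thesis .
  qed
  moreover have "{\<phi> x, \<phi> y} \<subseteq> draw A" using vertex_in_draw [OF A(2)] xyV U by auto
  ultimately have reg: "region (A \<union> B) = region (A \<union> P) \<union> region (B \<union> P)"
      "region (A \<union> P) \<inter> region (B \<union> P) = draw P"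
    using theta_regions [OF _ th] by auto
  show "verts_in (A \<union> B) = verts_in (A \<union> P) \<union> verts_in (B \<union> P)"
    by (auto simp: verts_in_def reg)
  have "verts_in (A \<union> P) \<inter> verts_in (B \<union> P) = {v \<in> verts G. \<phi> v \<in> draw P}"
    using reg(2) by (auto simp: verts_in_def)
  also have "\<dots> = \<Union>P" using vertex_in_draw [OF P(2)] P(2) edgeD(1) by blast
  finally show "verts_in (A \<union> P) \<inter> verts_in (B \<union> P) = set (x # p @ [y])" using U by simp
  have "edges_in (A \<union> P) \<inter> edges_in (B \<union> P) = {e \<in> edges G. path_image (\<gamma> e) \<subseteq> draw P}"
    using reg(2) by (auto simp: edges_in_def)
  then show "edges_in (A \<union> P) \<inter> edges_in (B \<union> P) = P"
    using edge_subset_draw [OF P(2)] P(2) by blast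
  have "e \<in> edges_in (A \<union> P) \<union> edges_in (B \<union> P)" if e: "e \<in> edges_in (A \<union> B)" for e
  proof (cases "e \<in> A \<union> B \<union> P")
    case True
    then show ?thesis
      using edges_in_superset [of "A \<union> P"] edges_in_superset [of "B \<union> P"] A B P by blast
  next
    case False
    \<comment> \<open>The open edge is connected and misses all three arcs, so one of its points
      decides on which side of the ear all of it lies.\<close>
    let ?O = "path_image (\<gamma> e) - \<phi> ` e"
    have eE: "e \<in> edges G" "path_image (\<gamma> e) \<subseteq> region (A \<union> B)" using e by (auto simp: edges_in_def)
    have sub: "A \<union> B \<subseteq> edges G" "A \<union> P \<subseteq> edges G" "B \<union> P \<subseteq> edges G" using A B P by auto
    have dj: "?O \<inter> draw (A \<union> B) = {}" "?O \<inter> draw (A \<union> P) = {}" "?O \<inter> draw (B \<union> P) = {}"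
      by (rule open_edge_disjoint_draw; use sub eE False in auto)+
    have in_edges: "e \<in> edges_in F" if "F \<subseteq> edges G" "?O \<subseteq> inside (draw F)" for F
      using edge_subset_closed [OF eE(1) closed_region [OF that(1)]] that eE
      by (auto simp: edges_in_def region_eq)
    obtain t where t: "t \<in> ?O" using open_edge(2) [OF eE(1)] by blast
    have "t \<in> inside (draw (A \<union> B))" using t dj(1) eE by (auto simp: region_eq)
    then have "t \<in> inside (draw (A \<union> P)) \<or> t \<in> inside (draw (B \<union> P))"
      using th(2) t dj by (auto simp: draw_Un)
    then show ?thesis
      using connected_subset_inside [OF open_edge(1) [OF eE(1)] dj(2) t]
        connected_subset_inside [OF open_edge(1) [OF eE(1)] dj(3) t] in_edges sub by blast
  qed
  then show "edges_in (A \<union> B) = edges_in (A \<union> P) \<union> edges_in (B \<union> P)"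
    by (auto simp: edges_in_def reg)
qed

text \<open>Induction on the number \<open>e\<close> of enclosed edges. With nothing inside,
  \<open>e = v = |C|\<close> and the claim reads \<open>4 \<le> |C|\<close>. Otherwise an ear with
  \<open>l\<close> edges gives \<open>e1 + e2 = e + l\<close>, \<open>v1 + v2 = v + l + 1\<close>
  and \<open>|C1| + |C2| = |C| + 2 * l\<close>; adding the two inductive bounds gives exactly the
  claim.\<close>

lemma cycle_bound:
  assumes "biconnected G" and girth: "\<And>c. is_cycle G c \<Longrightarrow> 4 \<le> length c" and c: "is_cycle G c"
  shows "2 * card (edges_in (cycle_edges c)) + length c + 4 \<le> 4 * card (verts_in (cycle_edges c))"
  using c
proof (induction "card (edges_in (cycle_edges c))" arbitrary: c rule: less_induct)
  case less
  let ?C = "cycle_edges c"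
  have CE: "?C \<subseteq> edges G" and cV: "set c \<subseteq> verts G" and len: "3 \<le> length c" and dc: "distinct c"
    using less.prems by (auto simp: is_cycle_iff)
  show ?case
  proof (cases "edges_in ?C = ?C \<and> verts_in ?C = set c")
    case True
    then show ?thesis
      using card_cycle_edges [OF dc len] distinct_card [OF dc] girth [OF less.prems] by simp
  next
    case False
    then obtain x y p where ear: "x \<in> set c" "y \<in> set c" "x \<noteq> y" "distinct p" "set p \<inter> set c = {}"
      and PE: "path_edges (x # p @ [y]) \<subseteq> edges G" "path_edges (x # p @ [y]) \<inter> ?C = {}"
         "draw (path_edges (x # p @ [y])) \<inter> inside (draw ?C) \<noteq> {}"
      using inner_ear [OF assms(1) less.prems] by metis
    obtain a b where ab: "distinct (x # a @ y # b)" "set (x # a @ y # b) = set c"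
        "length (x # a @ y # b) = length c"
        "?C = path_edges (x # a @ [y]) \<union> path_edges (x # b @ [y])"
        "path_edges (x # a @ [y]) \<inter> path_edges (x # b @ [y]) = {}"
      using cycle_split [OF dc len ear(1-3)] by metis
    define A where "A = path_edges (x # a @ [y])"
    define B where "B = path_edges (x # b @ [y])"
    define P where "P = path_edges (x # p @ [y])"
    have cd: "card A = length a + 1" "card B = length b + 1" "card P = length p + 1"
      unfolding A_def B_def P_def using ab ear by (subst card_path_edges; auto)+
    have C: "?C = A \<union> B" using ab by (simp add: A_def B_def)
    have AB: "A \<inter> B = {}" using ab(5) by (simp add: A_def B_def)
    have dj: "A \<inter> P = {}" "B \<inter> P = {}" using PE C P_def by auto
    have sub: "A \<subseteq> edges G" "B \<subseteq> edges G" "P \<subseteq> edges G" using CE C PE P_def by auto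
    have "draw P \<inter> inside (draw (A \<union> B)) \<noteq> {}" using PE(3) C P_def by simp
    note sp = ear_split [OF ab(1) ear(4) _ A_def sub(1) B_def sub(2) P_def sub(3) AB dj this,
        unfolded ab(2), OF ear(5)]
    have pV: "set p \<subseteq> verts G"
      using Union_path_edges [of "x # p @ [y]"] PE(1) edgeD(1) by auto
    have cyc: "is_cycle G (x # q @ y # rev p)"
      if "distinct (x # q @ [y])" "set q \<subseteq> set c" "path_edges (x # q @ [y]) \<inter> P = {}"
        "path_edges (x # q @ [y]) \<subseteq> edges G" for q
      unfolding is_cycle_iff
    proof (intro conjI)
      \<comment> \<open>If both were empty, the arc and the ear would be the same edge; so the new
        cycle has a third vertex.\<close>
      have "q \<noteq> [] \<or> p \<noteq> []" using that(3) P_def by auto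
      then show "3 \<le> length (x # q @ y # rev p)" by (auto simp: Suc_le_eq neq_Nil_conv)
      show "distinct (x # q @ y # rev p)" using that(1,2) ear by auto
      show "set (x # q @ y # rev p) \<subseteq> verts G" using that(2) ear(1,2) cV pV by auto
      show "cycle_edges (x # q @ y # rev p) \<subseteq> edges G"
        using that(4) PE(1) by (simp add: cycle_edges_two_paths)
    qed
    have ab': "distinct (x # a @ [y])" "distinct (x # b @ [y])" "set a \<subseteq> set c" "set b \<subseteq> set c"
      using ab(1) unfolding ab(2) [symmetric] by auto
    have c1: "is_cycle G (x # a @ y # rev p)" "cycle_edges (x # a @ y # rev p) = A \<union> P"
      using cyc [of a] ab' dj sub by (simp_all add: cycle_edges_two_paths A_def P_def)
    have c2: "is_cycle G (x # b @ y # rev p)" "cycle_edges (x # b @ y # rev p) = B \<union> P"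
      using cyc [of b] ab' dj sub by (simp_all add: cycle_edges_two_paths B_def P_def)
    have "A \<noteq> {}" "B \<noteq> {}" using cd by auto
    \<comment> \<open>The two sides share only edges of \<open>P\<close>, so each one misses the
      opposite nonempty arc and has strictly fewer edges.\<close>
    have "A \<inter> edges_in (B \<union> P) = {}" "B \<inter> edges_in (A \<union> P) = {}"
      using sp(4) edges_in_superset [of "A \<union> P"] edges_in_superset [of "B \<union> P"] sub dj by blast+
    moreover have "A \<subseteq> edges_in ?C" "B \<subseteq> edges_in ?C" using edges_in_superset [OF CE] C by auto
    ultimately have "edges_in (A \<union> P) \<subset> edges_in ?C" "edges_in (B \<union> P) \<subset> edges_in ?C"
      using sp(3) \<open>A \<noteq> {}\<close> \<open>B \<noteq> {}\<close> unfolding C by blast+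
    then have lt: "card (edges_in (A \<union> P)) < card (edges_in ?C)" "card (edges_in (B \<union> P)) < card (edges_in ?C)"
      by (auto intro: psubset_card_mono finite_edges_in)
    have 1: "2 * card (edges_in (A \<union> P)) + (length a + length p + 2) + 4 \<le> 4 * card (verts_in (A \<union> P))"
      using less.hyps [OF _ c1(1)] lt(1) c1(2) by simp
    have 2: "2 * card (edges_in (B \<union> P)) + (length b + length p + 2) + 4 \<le> 4 * card (verts_in (B \<union> P))"
      using less.hyps [OF _ c2(1)] lt(2) c2(2) by simp
    have 3: "card (edges_in (A \<union> P)) + card (edges_in (B \<union> P)) = card (edges_in ?C) + (length p + 1)"
      using card_Un_Int [OF finite_edges_in finite_edges_in, of "A \<union> P" "B \<union> P"] sp(3,4) C cd(3) by simp
    have "card (set (x # p @ [y])) = length p + 2"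
      using ear by (subst distinct_card) auto
    then have 4: "card (verts_in (A \<union> P)) + card (verts_in (B \<union> P)) = card (verts_in ?C) + (length p + 2)"
      using card_Un_Int [OF finite_verts_in finite_verts_in, of "A \<union> P" "B \<union> P"] sp(1,2) C by simp
    have "length a + length b + 2 = length c" using ab(3) by simp
    then show ?thesis using 1 2 3 4 by linarith
  qed
qed

end

subsection \<open>The edge bound for plane graphs of girth at least 4\<close>

context plane_graph
begin

text \<open>Finitely many closed sets with empty interior have a union with empty interior. This
  leaves room for an inversion centre off the drawing.\<close>

lemma interior_draw_empty:
  assumes "F \<subseteq> edges G"
  shows "interior (draw F) = {}"
proof -
  have "finite F" using assms finite_edges finite_subset by blast
  then show ?thesis using assms
  proof (induction F)
    case empty
    then show ?case by (simp add: draw_def)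
  next
    case (insert e F)
    have "draw (insert e F) = draw F \<union> path_image (\<gamma> e)" by (auto simp: draw_def)
    moreover have "closed (draw F)" using compact_draw [of F] insert by (auto intro: compact_imp_closed)
    moreover have "interior (path_image (\<gamma> e)) = {}"
      using edge_arc(1) [of e] insert.prems by (simp add: interior_arc_empty)
    ultimately show ?case using interior_closed_Un_empty_interior [of "draw F" "path_image (\<gamma> e)"] insert by simp
  qed
qed

text \<open>The two arcs between the first and the last vertex, one of them reversed, join to a
  closed curve fit for the Jordan curve theorem.\<close>

lemma cycle_loop:
  assumes "is_cycle G c"
  obtains g where "simple_path g" "pathfinish g = pathstart g" "path_image g = draw (cycle_edges c)"
proof -
  have CE: "cycle_edges c \<subseteq> edges G" and len: "3 \<le> length c" and dc: "distinct c"
    using assms by (auto simp: is_cycle_iff)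
  have "hd c \<in> set c" "last c \<in> set c" "hd c \<noteq> last c"
    using len dc by (cases c; auto)+
  then obtain a b where ab: "distinct (hd c # a @ last c # b)"
      "cycle_edges c = path_edges (hd c # a @ [last c]) \<union> path_edges (hd c # b @ [last c])"
      "path_edges (hd c # a @ [last c]) \<inter> path_edges (hd c # b @ [last c]) = {}"
    using cycle_split [OF dc len] by metis
  define A where "A = path_edges (hd c # a @ [last c])"
  define B where "B = path_edges (hd c # b @ [last c])"
  have C: "cycle_edges c = A \<union> B" using ab(2) by (simp add: A_def B_def)
  have dj: "A \<inter> B = {}" using ab(3) by (simp add: A_def B_def)
  have AE: "A \<subseteq> edges G" "B \<subseteq> edges G" using CE C by auto
  have U: "\<Union>A = set (hd c # a @ [last c])" "\<Union>B = set (hd c # b @ [last c])"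
    unfolding A_def B_def by (rule Union_path_edges; simp)+
  obtain g1 where g1: "arc g1" "pathstart g1 = \<phi> (hd c)" "pathfinish g1 = \<phi> (last c)" "path_image g1 = draw A"
    using path_arc [of "hd c # a @ [last c]"] ab AE A_def by auto
  obtain g2 where g2: "arc g2" "pathstart g2 = \<phi> (hd c)" "pathfinish g2 = \<phi> (last c)" "path_image g2 = draw B"
    using path_arc [of "hd c # b @ [last c]"] ab AE B_def by auto
  have "draw A \<inter> draw B = {\<phi> (hd c), \<phi> (last c)}"
    using draw_inter [OF AE dj] ab(1) unfolding U by auto
  then have "simple_path (g1 +++ reversepath g2)"
    using g1 g2 by (intro simple_path_join_loop) (auto simp: arc_reversepath)
  moreover have "path_image (g1 +++ reversepath g2) = draw (cycle_edges c)"
    using g1 g2 by (subst path_image_join) (auto simp: C draw_Un)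
  ultimately show thesis using that [of "g1 +++ reversepath g2"] g1 g2 by simp
qed

text \<open>\<open>cycle_bound\<close> is used for the given drawing and for an inverted one, where
  the outside of \<open>C\<close> has become its inside. Edges of \<open>C\<close> are counted on
  both sides, and only vertices of \<open>C\<close> are; so \<open>e + |C| \<le> e1 + e2\<close> and
  \<open>v1 + v2 \<le> v + |C|\<close>. In the sum of the two bounds \<open>|C|\<close>
  cancels.\<close>

lemma biconnected_bound:
  assumes bi: "biconnected G" and girth: "\<And>c. is_cycle G c \<Longrightarrow> 4 \<le> length c" and c: "is_cycle G c"
  shows "card (edges G) + 4 \<le> 2 * card (verts G)"
proof -
  let ?C = "cycle_edges c"
  let ?D = "draw ?C"
  have CE: "?C \<subseteq> edges G" and len: "3 \<le> length c" and dc: "distinct c"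
    using c by (auto simp: is_cycle_iff)
  have UC: "\<Union>?C = set c" using len by (intro Union_cycle_edges) auto
  obtain g where g: "simple_path g" "pathfinish g = pathstart g" "path_image g = ?D"
    using cycle_loop [OF c] .
  have J: "inside ?D \<noteq> {}" "open (inside ?D)" "connected (inside ?D)"
    using Jordan_inside_outside [OF g(1,2)] g(3) by auto
  have "closed (draw (edges G))" using compact_draw compact_imp_closed by blast
  then have "interior (draw (edges G) \<union> \<phi> ` verts G) = {}"
    using interior_closed_Un_empty_interior [of "draw (edges G)" "\<phi> ` verts G"]
      interior_draw_empty [of "edges G"] finite_verts by (simp add: empty_interior_finite)
  \<comment> \<open>The inside is open and nonempty, hence not covered by a set with empty interior;
    any uncovered point can serve as centre.\<close>
  then have "\<not> inside ?D \<subseteq> draw (edges G) \<union> \<phi> ` verts G"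
    using J interior_maximal by blast
  then obtain a where a: "a \<in> inside ?D" "a \<notin> draw (edges G)" "a \<notin> \<phi> ` verts G" by blast
  define h where "h = (\<lambda>z. inverse (z - a))"
  \<comment> \<open>The abstract graph is unchanged, so biconnectedness and the girth condition hold
    for the second drawing as well.\<close>
  interpret inv: plane_graph G "h \<circ> \<phi>" "\<lambda>e. h \<circ> \<gamma> e"
  proof
    show "plane_drawing G (h \<circ> \<phi>) (\<lambda>e. h \<circ> \<gamma> e)"
    proof (rule plane_drawing_compose [OF drawing])
      show "continuous_on (- {a}) h" unfolding h_def by (intro continuous_intros) auto
      show "inj_on h (- {a})" by (auto simp: inj_on_def h_def)
    qed (use a edgeD in \<open>auto simp: draw_def\<close>)
  qed (fact simple)
  have D': "inv.draw F = h ` draw F" for F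
    by (auto simp: inv.draw_def draw_def path_image_compose)
  have io: "z \<notin> ?D \<Longrightarrow> z \<noteq> a \<Longrightarrow> h z \<in> inside (h ` ?D) \<longleftrightarrow> z \<in> outside ?D" for z
    using inversion_inside [OF compact_draw [OF CE] J(3) a(1) _ _ h_def, of z]
      inversion_outside [OF compact_draw [OF CE] a(1) _ h_def, of z]
      inside_Un_outside [of ?D] inside_Int_outside [of "h ` ?D"] by blast
  have hD: "h z \<in> h ` ?D \<longleftrightarrow> z \<in> ?D" if "z \<noteq> a" for z
    using a(1) inside_no_overlap [of ?D] that by (auto simp: h_def)
  have inv_region: "h z \<in> inv.region ?C \<longleftrightarrow> z \<notin> inside ?D" if "z \<noteq> a" for z
    using io [of z] hD [of z] that inside_Un_outside [of ?D] inside_Int_outside [of ?D] inside_no_overlap [of ?D]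
    unfolding inv.region_eq D' by blast
  have 1: "2 * card (edges_in ?C) + length c + 4 \<le> 4 * card (verts_in ?C)"
    using cycle_bound [OF bi girth c] .
  have 2: "2 * card (inv.edges_in ?C) + length c + 4 \<le> 4 * card (inv.verts_in ?C)"
    using inv.cycle_bound [OF bi girth c] .
  have "edges G \<subseteq> edges_in ?C \<union> inv.edges_in ?C"
  proof
    fix e assume e: "e \<in> edges G"
    let ?O = "path_image (\<gamma> e) - \<phi> ` e"
    show "e \<in> edges_in ?C \<union> inv.edges_in ?C"
    proof (cases "e \<in> ?C")
      case True
      then show ?thesis using edges_in_superset [OF CE] by blast
    next
      case False
      have dj: "?O \<inter> ?D = {}" by (rule open_edge_disjoint_draw [OF CE e False])
      show ?thesis
      \<comment> \<open>The open edge lies wholly inside the cycle, or in the closed complement of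
        the inside, which the inversion carries into the region of the inverted cycle.\<close>
      proof (cases "?O \<inter> inside ?D = {}")
        case True
        then have "?O \<subseteq> - inside ?D" by blast
        then have "path_image (\<gamma> e) \<subseteq> - inside ?D"
          using J(2) by (intro edge_subset_closed [OF e]) (auto simp: closed_Compl)
        moreover have "a \<notin> path_image (\<gamma> e)" using a e by (auto simp: draw_def)
        ultimately have "path_image (h \<circ> \<gamma> e) \<subseteq> inv.region ?C"
          using inv_region by (fastforce simp: path_image_compose)
        then show ?thesis using e by (simp add: inv.edges_in_def)
      next
        case False
        then have "?O \<subseteq> inside ?D"
          using connected_subset_inside [OF open_edge(1) [OF e] dj] by blast
        then have "path_image (\<gamma> e) \<subseteq> region ?C"
          by (intro edge_subset_closed [OF e closed_region [OF CE]]) (auto simp: region_eq)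
        then show ?thesis using e by (simp add: edges_in_def)
      qed
    qed
  qed
  moreover have "?C \<subseteq> edges_in ?C \<inter> inv.edges_in ?C"
    using edges_in_superset [OF CE] inv.edges_in_superset [OF CE] by blast
  ultimately have "card (edges G) + length c \<le> card (edges_in ?C) + card (inv.edges_in ?C)"
    using card_Un_Int [OF finite_edges_in inv.finite_edges_in, of ?C ?C] card_cycle_edges [OF dc len]
      card_mono [of "edges_in ?C \<union> inv.edges_in ?C" "edges G"]
      card_mono [of "edges_in ?C \<inter> inv.edges_in ?C" ?C] finite_edges_in inv.finite_edges_in
    by simp
  moreover have "card (verts_in ?C) + card (inv.verts_in ?C) \<le> card (verts G) + length c"
  proof -
    have "verts_in ?C \<inter> inv.verts_in ?C \<subseteq> set c"
    proof
      fix v assume v: "v \<in> verts_in ?C \<inter> inv.verts_in ?C"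
      then have vV: "v \<in> verts G" "\<phi> v \<in> region ?C" "h (\<phi> v) \<in> inv.region ?C"
        by (auto simp: verts_in_def inv.verts_in_def)
      moreover have "\<phi> v \<noteq> a" using a vV by blast
      ultimately have "\<phi> v \<in> ?D" using inv_region by (auto simp: region_eq)
      then show "v \<in> set c" using vertex_in_draw [OF CE vV(1)] UC by blast
    qed
    then have "card (verts_in ?C \<inter> inv.verts_in ?C) \<le> length c"
      using card_mono distinct_card [OF dc] by (metis List.finite_set)
    moreover have "card (verts_in ?C \<union> inv.verts_in ?C) \<le> card (verts G)"
      by (rule card_mono) (auto simp: finite_verts verts_in_def inv.verts_in_def)
    ultimately show ?thesis
      using card_Un_Int [OF finite_verts_in inv.finite_verts_in, of ?C ?C] by simp
  qed
  ultimately show ?thesis using 1 2 by linarith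
qed

end

text \<open>The bound \<open>2 * N - 2\<close> already holds for a single vertex and adds up across
  separations of order at most one, so a counterexample with all smaller cases settled is
  biconnected. It also has a cycle, and then \<open>biconnected_bound\<close> gives even
  \<open>2 * N - 4\<close>.\<close>

lemma planar_girth4_sparse:
  assumes "simple_graph G" "planar G" "\<And>c. is_cycle G c \<Longrightarrow> 4 \<le> length c" "verts G \<noteq> {}"
  shows "card (edges G) + 2 \<le> 2 * card (verts G)"
  using assms
proof (induction "card (verts G)" arbitrary: G rule: less_induct)
  case less
  let ?E = "\<lambda>U. {e \<in> edges G. e \<subseteq> U}"
  obtain \<phi> \<gamma> where dr: "plane_drawing G \<phi> \<gamma>" using less.prems(2) by (auto simp: planar_def)
  interpret plane_graph G \<phi> \<gamma> using less.prems(1) dr by unfold_locales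
  \<comment> \<open>Subgraphs induced on proper nonempty vertex sets inherit the drawing and the
    girth condition.\<close>
  have sub: "card (?E U) + 2 \<le> 2 * card U" if U: "U \<subset> verts G" "U \<noteq> {}" for U
  proof -
    have "card (edges (U, ?E U)) + 2 \<le> 2 * card (verts (U, ?E U))"
    proof (rule less.hyps)
      show "card (verts (U, ?E U)) < card (verts G)"
        using U finite_verts by (simp add: psubset_card_mono)
      show "simple_graph (U, ?E U)"
        using U finite_verts edgeD by (auto simp: simple_graph_def intro: finite_subset)
      have "plane_drawing (U, ?E U) \<phi> \<gamma>"
        unfolding plane_drawing_def
      proof (intro conjI ballI impI)
        show "inj_on \<phi> (verts (U, ?E U))" using inj U by (auto intro: inj_on_subset)
        fix e assume "e \<in> edges (U, ?E U)"
        then have e: "e \<in> edges G" "e \<subseteq> U" by auto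
        show "arc (\<gamma> e)" "{pathstart (\<gamma> e), pathfinish (\<gamma> e)} = \<phi> ` e" using edge_arc e by auto
        show "path_image (\<gamma> e) \<inter> \<phi> ` verts (U, ?E U) = \<phi> ` e"
          using edge_arc(3) [OF e(1)] image_mono [OF e(2), of \<phi>] image_mono [of U "verts G" \<phi>] U(1)
          by auto
        fix f assume "f \<in> edges (U, ?E U)" "e \<noteq> f"
        then show "path_image (\<gamma> e) \<inter> path_image (\<gamma> f) = \<phi> ` (e \<inter> f)"
          using edge_inter e by auto
      qed
      then show "planar (U, ?E U)" by (auto simp: planar_def)
      show "4 \<le> length c" if "is_cycle (U, ?E U) c" for c
        using that U by (intro less.prems(3)) (auto simp: is_cycle_iff)
    qed (use U in auto)
    then show ?thesis by simp
  qed
  show ?case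
  proof (rule ccontr)
    assume many: "\<not> ?case"
    have "biconnected G"
      unfolding biconnected_def
    proof (intro allI impI)
      fix A B assume AB: "A \<union> B = verts G \<and> A \<noteq> verts G \<and> B \<noteq> verts G \<and> (\<forall>e\<in>edges G. e \<subseteq> A \<or> e \<subseteq> B)"
      then have fin: "finite A" "finite B" using finite_verts by (metis finite_Un)+
      have "edges G = ?E A \<union> ?E B" using AB by blast
      then have "card (edges G) \<le> card (?E A) + card (?E B)" by (metis card_Un_le)
      moreover have "A \<subset> verts G" "A \<noteq> {}" "B \<subset> verts G" "B \<noteq> {}" using AB by auto
      ultimately have "card (edges G) + 4 \<le> 2 * card A + 2 * card B"
        using sub [of A] sub [of B] by linarith
      also have "\<dots> = 2 * card (verts G) + 2 * card (A \<inter> B)"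
        using card_Un_Int [OF fin] AB by simp
      finally show "2 \<le> card (A \<inter> B)" using many by linarith
    qed
    \<comment> \<open>Deleting \<open>v\<close> lowers the bound by 2, so too dense a graph loses
      more than two edges. A single vertex is treated apart because the induction needs a nonempty
      rest.\<close>
    moreover have "2 \<le> card {e \<in> edges G. v \<in> e}" if v: "v \<in> verts G" for v
    proof (cases "verts G = {v}")
      case True
      have "e \<notin> edges G" for e
        using edgeD(1,2) [of e] True by (auto simp: card_2_iff)
      then have "edges G = {}" by blast
      then show ?thesis using many True by simp
    next
      case False
      have "card (?E (verts G - {v})) + 2 \<le> 2 * card (verts G - {v})"
        using v False by (intro sub) auto
      also have "\<dots> + 2 = 2 * card (verts G)"
        using card_Suc_Diff1 [OF finite_verts v] by linarith
      finally have "card (?E (verts G - {v})) + 4 \<le> 2 * card (verts G)" by simp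
      moreover have "edges G = ?E (verts G - {v}) \<union> {e \<in> edges G. v \<in> e}"
        using edgeD(1) by blast
      then have "card (edges G) \<le> card (?E (verts G - {v})) + card {e \<in> edges G. v \<in> e}"
        by (metis (no_types, lifting) card_Un_le)
      ultimately show ?thesis using many by linarith
    qed
    then obtain c where "is_cycle G c"
      using cycle_exists [OF less.prems(1,4)] by blast
    ultimately show False
      using biconnected_bound less.prems(3) many by fastforce
  qed
qed

subsection \<open>Grid drawings and token graphs of paths\<close>

text \<open>Inside a unit grid segment one coordinate is an integer and the other lies strictly
  between consecutive integers. Rounding both coordinates down or up thus recovers the two ends from
  any interior point.\<close>

lemma unit_segment:
  fixes a b :: nat
  assumes "z \<in> closed_segment (Complex a b) q" and q: "q = Complex (real a + 1) b \<or> q = Complex a (real b + 1)"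
  shows "Re z \<in> \<int> \<Longrightarrow> Im z \<in> \<int> \<Longrightarrow> z = Complex a b \<or> z = q"
    and "z \<noteq> Complex a b \<Longrightarrow> z \<noteq> q \<Longrightarrow> Complex a b = Complex \<lfloor>Re z\<rfloor> \<lfloor>Im z\<rfloor> \<and> q = Complex \<lceil>Re z\<rceil> \<lceil>Im z\<rceil>"
proof -
  obtain u where u: "0 \<le> u" "u \<le> 1" "z = (1 - u) *\<^sub>R Complex a b + u *\<^sub>R q"
    using assms(1) by (auto simp: in_segment)
  have z: "z = Complex (a + u) b \<and> q = Complex (a + 1) b \<or> z = Complex a (b + u) \<and> q = Complex a (b + 1)"
    using q u(3) by (auto simp: complex_eq_iff algebra_simps)
  have int: "u = 0 \<or> u = 1" if nu: "real n + u \<in> \<int>" for n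
  proof -
    obtain m where "real n + u = of_int m" using Ints_cases [OF nu] by metis
    then have m: "u = of_int (m - int n)" by simp
    then have "0 \<le> m - int n" "m - int n \<le> 1" using u by linarith+
    then show ?thesis using m by (cases "m - int n = 0") auto
  qed
  show "z = Complex a b \<or> z = q" if "Re z \<in> \<int>" "Im z \<in> \<int>"
    using z that int by auto
  show "Complex a b = Complex \<lfloor>Re z\<rfloor> \<lfloor>Im z\<rfloor> \<and> q = Complex \<lceil>Re z\<rceil> \<lceil>Im z\<rceil>" if "z \<noteq> Complex a b" "z \<noteq> q"
  proof -
    have "u \<noteq> 0" "u \<noteq> 1" using that z by auto
    then have "0 < u" "u < 1" using u by auto
    then have "\<lfloor>real n + u\<rfloor> = int n \<and> \<lceil>real n + u\<rceil> = int n + 1" for n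
      by (simp add: floor_eq_iff ceiling_eq_iff)
    then show ?thesis using z by auto
  qed
qed

text \<open>Edges become unit grid segments, and an interior point determines its segment, so there
  are no crossings. Each edge changes the parity of \<open>f + g\<close>, so there are no
  triangles.\<close>

lemma grid_graph:
  fixes f g :: "'a \<Rightarrow> nat"
  assumes inj: "inj_on (\<lambda>v. (f v, g v)) (verts G)" and V: "\<And>e. e \<in> edges G \<Longrightarrow> e \<subseteq> verts G"
    and step: "\<And>e. e \<in> edges G \<Longrightarrow> \<exists>u v. e = {u, v} \<and> (f v = f u + 1 \<and> g v = g u \<or> f v = f u \<and> g v = g u + 1)"
  shows "planar G" and "is_cycle G c \<Longrightarrow> 4 \<le> length c"
proof -
  define \<phi> where "\<phi> = (\<lambda>v. Complex (f v) (g v))"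
  have inj\<phi>: "inj_on \<phi> (verts G)" using inj by (auto simp: inj_on_def \<phi>_def)
  have "\<forall>e\<in>edges G. \<exists>uv. e = {fst uv, snd uv} \<and>
      (f (snd uv) = f (fst uv) + 1 \<and> g (snd uv) = g (fst uv) \<or> f (snd uv) = f (fst uv) \<and> g (snd uv) = g (fst uv) + 1)"
    using step by (metis fst_conv snd_conv)
  \<comment> \<open>The pair \<open>w e\<close> orders the ends of \<open>e\<close>, left or lower
    end first.\<close>
  then obtain w where w: "\<And>e. e \<in> edges G \<Longrightarrow> e = {fst (w e), snd (w e)} \<and>
      (f (snd (w e)) = f (fst (w e)) + 1 \<and> g (snd (w e)) = g (fst (w e)) \<or>
       f (snd (w e)) = f (fst (w e)) \<and> g (snd (w e)) = g (fst (w e)) + 1)"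
    by metis
  define p where "p = (\<lambda>e. \<phi> (fst (w e)))"
  define q where "q = (\<lambda>e. \<phi> (snd (w e)))"
  define \<gamma> where "\<gamma> = (\<lambda>e. linepath (p e) (q e))"
  have \<phi>e: "\<phi> ` e = {p e, q e}" if "e \<in> edges G" for e
    using w [OF that] unfolding p_def q_def by (metis image_empty image_insert)
  have im: "path_image (\<gamma> e) = closed_segment (p e) (q e)" for e by (simp add: \<gamma>_def)
  have lat: "Re (\<phi> v) \<in> \<int>" "Im (\<phi> v) \<in> \<int>" for v by (auto simp: \<phi>_def)
  have seg: "Re z \<in> \<int> \<Longrightarrow> Im z \<in> \<int> \<Longrightarrow> z \<in> \<phi> ` e"
     "z \<notin> \<phi> ` e \<Longrightarrow> p e = Complex \<lfloor>Re z\<rfloor> \<lfloor>Im z\<rfloor> \<and> q e = Complex \<lceil>Re z\<rceil> \<lceil>Im z\<rceil>"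
    if e: "e \<in> edges G" and z: "z \<in> path_image (\<gamma> e)" for e z
  proof -
    have q': "q e = Complex (real (f (fst (w e))) + 1) (g (fst (w e))) \<or> q e = Complex (f (fst (w e))) (real (g (fst (w e))) + 1)"
      using w [OF e] by (auto simp: q_def \<phi>_def)
    have p': "p e = Complex (f (fst (w e))) (g (fst (w e)))" by (simp add: p_def \<phi>_def)
    note us = unit_segment [of z "f (fst (w e))" "g (fst (w e))" "q e", folded p', OF z [unfolded im], OF q']
    show "Re z \<in> \<int> \<Longrightarrow> Im z \<in> \<int> \<Longrightarrow> z \<in> \<phi> ` e" using us(1) \<phi>e [OF e] by auto
    show "z \<notin> \<phi> ` e \<Longrightarrow> p e = Complex \<lfloor>Re z\<rfloor> \<lfloor>Im z\<rfloor> \<and> q e = Complex \<lceil>Re z\<rceil> \<lceil>Im z\<rceil>"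
      using us(2) \<phi>e [OF e] by auto
  qed
  have "plane_drawing G \<phi> \<gamma>"
    unfolding plane_drawing_def
  proof (intro conjI ballI impI)
    show "inj_on \<phi> (verts G)" by fact
    fix e assume e: "e \<in> edges G"
    have "p e \<noteq> q e" using w [OF e] by (auto simp: p_def q_def \<phi>_def)
    then show "arc (\<gamma> e)" by (simp add: \<gamma>_def)
    show "{pathstart (\<gamma> e), pathfinish (\<gamma> e)} = \<phi> ` e" using \<phi>e [OF e] by (simp add: \<gamma>_def)
    have ends: "\<phi> ` e \<subseteq> path_image (\<gamma> e)" if "e \<in> edges G" for e using \<phi>e [OF that] by (auto simp: im)
    show "path_image (\<gamma> e) \<inter> \<phi> ` verts G = \<phi> ` e"
      using ends [OF e] V [OF e] seg(1) [OF e] lat by blast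
    fix e' assume e': "e' \<in> edges G" "e \<noteq> e'"
    have "z \<in> \<phi> ` e \<inter> \<phi> ` e'" if z: "z \<in> path_image (\<gamma> e)" "z \<in> path_image (\<gamma> e')" for z
    proof -
      \<comment> \<open>A point interior to both edges would give them the same ends. Hence it is a
        vertex of one edge, has integer coordinates, and is therefore a vertex of the other
        too.\<close>
      have "z \<in> \<phi> ` e \<or> z \<in> \<phi> ` e'"
      proof (rule ccontr)
        assume n: "\<not> ?thesis"
        have "p e = p e'" "q e = q e'"
          using seg(2) [OF e z(1)] seg(2) [OF e'(1) z(2)] n by auto
        then have "fst (w e) = fst (w e')" "snd (w e) = snd (w e')"
          using inj\<phi> w [OF e] w [OF e'(1)] V [OF e] V [OF e'(1)] unfolding p_def q_def
          by (metis inj_onD insert_subset)+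
        then show False using w [OF e] w [OF e'(1)] e'(2) by metis
      qed
      then show ?thesis using seg(1) [OF e z(1)] seg(1) [OF e'(1) z(2)] lat by blast
    qed
    then show "path_image (\<gamma> e) \<inter> path_image (\<gamma> e') = \<phi> ` (e \<inter> e')"
      using inj_on_image_Int [OF inj\<phi> V [OF e] V [OF e'(1)]] ends [OF e] ends [OF e'(1)] by blast
  qed
  then show "planar G" by (auto simp: planar_def)
  show "4 \<le> length c" if c: "is_cycle G c"
  proof (rule ccontr)
    assume "\<not> 4 \<le> length c"
    then have "length c = 3" using c by (simp add: is_cycle_def)
    then obtain x y z where xyz: "c = [x, y, z]"
      by (auto simp: length_Suc_conv numeral_3_eq_3)
    have par: "even (f u + g u) \<noteq> even (f v + g v)" if "{u, v} \<in> edges G" for u v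
      using step [OF that] by (auto simp: doubleton_eq_iff)
    show False
      using c par [of x y] par [of y z] par [of z x] by (auto simp: is_cycle_def is_path_def xyz)
  qed
qed

text \<open>In a token move one token travels along the edge \<open>xy\<close> while the other rests
  at \<open>z\<close>.\<close>

lemma token_edge_cases:
  assumes G: "simple_graph G" and T: "T \<in> edges (token_graph 2 G)"
  obtains x y z where "{x, y} \<in> edges G" "x \<noteq> y" "z \<noteq> x" "z \<noteq> y" "z \<in> verts G" "T = {{x, z}, {y, z}}"
proof -
  obtain X Y x y where XY: "T = {X, Y}" "X \<subseteq> verts G" "card X = 2" "card Y = 2" "x \<in> X" "y \<in> Y"
      "sym_diff X Y = {x, y}" "{x, y} \<in> edges G"
    using T by (auto simp: token_graph_def)
  have "x \<noteq> y" using G XY by (auto simp: simple_graph_def)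
  obtain z where z: "X = {x, z}" "z \<noteq> x" using XY(3,5) by (auto simp: card_2_iff)
  obtain w where w: "Y = {y, w}" "w \<noteq> y" using XY(4,6) by (auto simp: card_2_iff)
  have "x \<notin> Y" "y \<notin> X" using XY by auto
  then have "z = w" using XY(7) z w \<open>x \<noteq> y\<close> by auto
  then show thesis using that [of x y z] XY z w \<open>x \<noteq> y\<close> by auto
qed

lemma token_edgeI:
  assumes e: "{x, y} \<in> edges G" and V: "x \<in> verts G" "y \<in> verts G" "z \<in> verts G"
    and ne: "x \<noteq> y" "z \<noteq> x" "z \<noteq> y"
  shows "{{x, z}, {y, z}} \<in> edges (token_graph 2 G)"
proof -
  have sd: "sym_diff {x, z} {y, z} = {x, y}" using ne by auto
  have "\<exists>u\<in>{x, z}. \<exists>v\<in>{y, z}. sym_diff {x, z} {y, z} = {u, v} \<and> {u, v} \<in> edges G"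
  proof (intro bexI conjI)
    show "sym_diff {x, z} {y, z} = {x, y}" "{x, y} \<in> edges G" by fact+
  qed simp_all
  moreover have "{x, z} \<subseteq> verts G" "card {x, z} = 2" "{y, z} \<subseteq> verts G" "card {y, z} = 2"
    using V ne by auto
  ultimately show ?thesis
    unfolding token_graph_def snd_conv mem_Collect_eq
    by (intro exI [of "\<lambda>X. \<exists>Y. _ X Y" "{x, z}"] exI [of _ "{y, z}"] conjI refl finite.intros)
qed

text \<open>Each move uses a single edge and so belongs to the part containing it; since all parts
  keep the full vertex set \<open>V\<close>, the resting token has the same freedom in each.\<close>

lemma token_edges_Union:
  assumes "simple_graph (V, \<Union>P)"
  shows "edges (token_graph 2 (V, \<Union>P)) = (\<Union>p\<in>P. edges (token_graph 2 (V, p)))"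
proof (intro equalityI subsetI)
  fix T assume "T \<in> edges (token_graph 2 (V, \<Union>P))"
  with assms show "T \<in> (\<Union>p\<in>P. edges (token_graph 2 (V, p)))"
  proof (cases rule: token_edge_cases)
    case (1 x y z)
    then obtain p where p: "p \<in> P" "{x, y} \<in> p" by auto
    have "{x, y} \<subseteq> V" using p assms unfolding simple_graph_def fst_conv snd_conv by blast
    then have "T \<in> edges (token_graph 2 (V, p))"
      unfolding 1(6) using 1 p by (intro token_edgeI) auto
    then show ?thesis using p by blast
  qed
next
  fix T assume "T \<in> (\<Union>p\<in>P. edges (token_graph 2 (V, p)))"
  then obtain p where p: "p \<in> P" "T \<in> edges (token_graph 2 (V, p))" by blast
  have "simple_graph (V, p)" using assms p(1) by (auto simp: simple_graph_def)
  from this p(2) show "T \<in> edges (token_graph 2 (V, \<Union>P))"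
  proof (cases rule: token_edge_cases)
    case (1 x y z)
    have "{x, y} \<subseteq> V" using 1(1) p(1) assms unfolding simple_graph_def fst_conv snd_conv by blast
    then show ?thesis
      unfolding 1(6) using 1 p by (intro token_edgeI) auto
  qed
qed

lemma simple_token_graph:
  assumes "simple_graph G"
  shows "simple_graph (token_graph 2 G)"
proof -
  have "finite {X. X \<subseteq> verts G \<and> finite X \<and> card X = 2}"
    by (rule finite_subset [of _ "Pow (verts G)"]) (use assms in \<open>auto simp: simple_graph_def\<close>)
  moreover have "T \<subseteq> verts (token_graph 2 G) \<and> card T = 2" if T: "T \<in> edges (token_graph 2 G)" for T
  proof -
    obtain x y z where xyz: "{x, y} \<in> edges G" "x \<noteq> y" "z \<noteq> x" "z \<noteq> y" "z \<in> verts G" "T = {{x, z}, {y, z}}"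
      using token_edge_cases [OF assms T] .
    then have "{x, z} \<noteq> {y, z}" by (auto simp: doubleton_eq_iff)
    then show ?thesis using xyz assms by (auto simp: simple_graph_def token_graph_def)
  qed
  ultimately show ?thesis by (auto simp: simple_graph_def token_graph_def)
qed

lemma path_graph_simple:
  assumes "distinct xs"
  shows "simple_graph (set xs, path_edges xs)"
proof -
  have "card e = 2" if e: "e \<in> path_edges xs" for e
  proof -
    obtain i where "e = {xs ! i, xs ! Suc i}" "Suc i < length xs" using e by (auto simp: path_edges_def)
    moreover then have "xs ! i \<noteq> xs ! Suc i" using assms by (simp add: nth_eq_iff_index_eq)
    ultimately show ?thesis by simp
  qed
  then show ?thesis by (auto simp: simple_graph_def dest: path_edges_subset)
qed

text \<open>The smaller and the larger token position serve as grid coordinates; a move along the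
  path changes one of them by one.\<close>

lemma token_graph_path:
  assumes "distinct xs"
  shows "planar (token_graph 2 (set xs, path_edges xs))"
    and "is_cycle (token_graph 2 (set xs, path_edges xs)) c \<Longrightarrow> 4 \<le> length c"
proof -
  let ?H = "token_graph 2 (set xs, path_edges xs)"
  define pos where "pos = the_inv_into {..<length xs} ((!) xs)"
  have inj: "inj_on ((!) xs) {..<length xs}" using assms by (simp add: inj_on_nth)
  have pos: "pos (xs ! i) = i" if "i < length xs" for i
    unfolding pos_def using the_inv_into_f_f [OF inj] that by simp
  have posi: "inj_on pos (set xs)"
    by (rule inj_onI) (metis in_set_conv_nth pos)
  define f where "f = (\<lambda>X. Min (pos ` X))"
  define g where "g = (\<lambda>X. Max (pos ` X))"
  have fg: "f {u, v} = min (pos u) (pos v)" "g {u, v} = max (pos u) (pos v)" for u v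
    by (auto simp: f_def g_def)
  have inj_fg: "inj_on (\<lambda>v. (f v, g v)) (verts ?H)"
  proof (rule inj_onI)
    fix X Y assume X: "X \<in> verts ?H" and Y: "Y \<in> verts ?H" and eq: "(f X, g X) = (f Y, g Y)"
    obtain a b where a: "X = {a, b}" "a \<in> set xs" "b \<in> set xs"
      using X by (auto simp: token_graph_def card_2_iff)
    obtain c d where c: "Y = {c, d}" "c \<in> set xs" "d \<in> set xs"
      using Y by (auto simp: token_graph_def card_2_iff)
    have "min (pos a) (pos b) = min (pos c) (pos d)" "max (pos a) (pos b) = max (pos c) (pos d)"
      using eq by (auto simp: a c fg)
    then have "pos a = pos c \<and> pos b = pos d \<or> pos a = pos d \<and> pos b = pos c"
      by (auto simp: min_def max_def split: if_splits)
    then show "X = Y" using posi a c by (auto dest: inj_onD)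
  qed
  have sg: "simple_graph ?H" by (intro simple_token_graph path_graph_simple assms)
  have step: "\<exists>X Y. T = {X, Y} \<and> (f Y = f X + 1 \<and> g Y = g X \<or> f Y = f X \<and> g Y = g X + 1)"
    if T: "T \<in> edges ?H" for T
  proof -
    have "\<exists>x y z. {x, y} \<in> path_edges xs \<and> z \<noteq> x \<and> z \<noteq> y \<and> z \<in> set xs \<and> T = {{x, z}, {y, z}}"
      by (rule token_edge_cases [OF path_graph_simple [OF assms] T]) (simp, blast)
    then obtain x y z where xyz: "{x, y} \<in> path_edges xs" "z \<noteq> x" "z \<noteq> y" "z \<in> set xs" "T = {{x, z}, {y, z}}"
      by blast
    obtain i where i: "{x, y} = {xs ! i, xs ! Suc i}" "Suc i < length xs"
      using xyz(1) by (auto simp: path_edges_def)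
    obtain j where j: "z = xs ! j" "j < length xs" using xyz(4) by (auto simp: in_set_conv_nth)
    have T': "T = {{xs ! i, z}, {xs ! Suc i, z}}" "z \<noteq> xs ! i" "z \<noteq> xs ! Suc i"
      using i(1) xyz by (auto simp: doubleton_eq_iff)
    \<comment> \<open>The resting token is at neither end of the move, so the order of the tokens is
      kept.\<close>
    then have "j \<noteq> i" "j \<noteq> Suc i" using j by auto
    then have "f {xs ! Suc i, z} = f {xs ! i, z} + 1 \<and> g {xs ! Suc i, z} = g {xs ! i, z} \<or>
        f {xs ! Suc i, z} = f {xs ! i, z} \<and> g {xs ! Suc i, z} = g {xs ! i, z} + 1"
      using i(2) j pos by (auto simp: fg min_def max_def)
    then show ?thesis using T'(1) by blast
  qed
  have V: "\<And>e. e \<in> edges ?H \<Longrightarrow> e \<subseteq> verts ?H" using sg by (auto simp: simple_graph_def)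
  show "planar ?H" by (rule grid_graph(1) [OF inj_fg V step])
  show "is_cycle ?H c \<Longrightarrow> 4 \<le> length c" by (rule grid_graph(2) [OF inj_fg V step])
qed

text \<open>An edge together with a resting token off it determines a move, and each edge leaves
  \<open>card (verts G) - 2\<close> places for that token.\<close>

lemma card_token_edges:
  assumes G: "simple_graph G"
  shows "card (edges G) * (card (verts G) - 2) \<le> card (edges (token_graph 2 G))"
proof -
  define h where "h = (\<lambda>(e, z). (\<lambda>x. {x, z :: 'a}) ` e)"
  let ?S = "Sigma (edges G) (\<lambda>e. verts G - e)"
  have ed: "\<And>e. e \<in> edges G \<Longrightarrow> e \<subseteq> verts G \<and> card e = 2" and fin: "finite (verts G)"
    using G by (auto simp: simple_graph_def)
  have finE: "finite (edges G)" by (rule finite_subset [of _ "Pow (verts G)"]) (use ed fin in auto)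
  \<comment> \<open>The resting token is the common element of both configurations, and the edge
    consists of the other elements; hence \<open>h\<close> is injective.\<close>
  have rec: "\<Inter>(h (e, z)) = {z} \<and> \<Union>(h (e, z)) - {z} = e" if ez: "e \<in> edges G" "z \<in> verts G - e" for e z
  proof -
    obtain x y where "e = {x, y}" "x \<noteq> y" using ed [OF ez(1)] by (auto simp: card_2_iff)
    then show ?thesis using ez by (auto simp: h_def)
  qed
  have "inj_on h ?S"
  proof (rule inj_onI, clarify)
    fix e z e' z' assume *: "e \<in> edges G" "z \<in> verts G" "z \<notin> e" "e' \<in> edges G" "z' \<in> verts G" "z' \<notin> e'"
      and eq: "h (e, z) = h (e', z')"
    have 1: "\<Inter>(h (e, z)) = {z}" "\<Union>(h (e, z)) - {z} = e" using rec [of e z] *(1-3) by simp_all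
    have 2: "\<Inter>(h (e', z')) = {z'}" "\<Union>(h (e', z')) - {z'} = e'" using rec [of e' z'] *(4-6) by simp_all
    have "z = z'" using 1(1) 2(1) unfolding eq by simp
    then show "e = e' \<and> z = z'" using 1(2) 2(2) unfolding eq by simp
  qed
  then have "card ?S = card (h ` ?S)" by (simp add: card_image)
  also have "\<dots> \<le> card (edges (token_graph 2 G))"
  proof (rule card_mono)
    have sg: "simple_graph (token_graph 2 G)" by (rule simple_token_graph [OF G])
    show "finite (edges (token_graph 2 G))"
      by (rule finite_subset [of _ "Pow (verts (token_graph 2 G))"]) (use sg in \<open>auto simp: simple_graph_def\<close>)
    show "h ` ?S \<subseteq> edges (token_graph 2 G)"
    proof clarify
      fix e z assume ez: "e \<in> edges G" "z \<in> verts G" "z \<notin> e"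
      obtain x y where "e = {x, y}" "x \<noteq> y" using ed [OF ez(1)] by (auto simp: card_2_iff)
      then show "h (e, z) \<in> edges (token_graph 2 G)"
        using token_edgeI [of x y G z] ez ed [OF ez(1)] by (auto simp: h_def)
    qed
  qed
  also have "card ?S = (\<Sum>e\<in>edges G. card (verts G - e))"
    using finE fin by (intro card_SigmaI) auto
  also have "\<dots> = card (edges G) * (card (verts G) - 2)"
  proof -
    have "card (verts G - e) = card (verts G) - 2" if "e \<in> edges G" for e
      using ed [OF that] fin by (metis card_Diff_subset finite_subset)
    then show ?thesis by simp
  qed
  finally show ?thesis by simp
qed

subsection \<open>Girth thickness of the 2-token graph\<close>

lemma girth_ge_iff: "enat g \<le> girth G \<longleftrightarrow> (\<forall>c. is_cycle G c \<longrightarrow> g \<le> length c)"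
  by (auto simp: girth_def le_INF_iff)

theorem theorem1:
  fixes G :: "'a ugraph" and k :: nat
  assumes "simple_graph G"
    and "1 \<le> k"
    and "hamiltonian_path_factorization G k"
  shows "girth_thickness 4 (token_graph 2 G) = k"
proof -
  let ?H = "token_graph 2 G" and ?V = "verts G"
  define n where "n = card ?V"
  define Q where "Q = (\<lambda>m. \<exists>S. finite S \<and> card S = m \<and>
        (\<forall>K\<in>S. subgraph K ?H \<and> planar K \<and> enat 4 \<le> girth K) \<and>
        (\<Union>K\<in>S. verts K) = verts ?H \<and> (\<Union>K\<in>S. edges K) = edges ?H)"
  have fin: "finite ?V" and ed: "\<And>e. e \<in> edges G \<Longrightarrow> e \<subseteq> ?V \<and> card e = 2"
    using assms(1) by (auto simp: simple_graph_def)
  obtain P where P: "partition_on (edges G) P" "finite P" "card P = k"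
      "\<And>p. p \<in> P \<Longrightarrow> \<exists>xs. hamiltonian_path G xs \<and> p = path_edges xs"
    using assms(3) by (auto simp: hamiltonian_path_factorization_def)
  have UP: "\<Union>P = edges G" using P(1) by (simp add: partition_on_def)
  have "P \<noteq> {}" using P(2,3) assms(2) by auto
  have path: "\<exists>xs. distinct xs \<and> set xs = ?V \<and> p = path_edges xs" if "p \<in> P" for p
    using P(4) [OF that] by (auto simp: hamiltonian_path_def is_path_def)
  have cp: "card p = n - 1" if "p \<in> P" for p
    using path [OF that] card_path_edges distinct_card unfolding n_def by metis
  \<comment> \<open>Parts of a partition are nonempty, so each path has an edge.\<close>
  have n2: "2 \<le> n"
  proof -
    obtain p where p: "p \<in> P" using \<open>P \<noteq> {}\<close> by blast
    then have "p \<noteq> {}" using P(1) by (auto simp: partition_on_def)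
    moreover have "finite p" using path [OF p] by auto
    ultimately have "0 < card p" by (simp add: card_gt_0_iff)
    then show ?thesis using cp [OF p] by simp
  qed
  have cE: "card (edges G) = k * (n - 1)"
  proof -
    have "card (\<Union>P) = sum card P"
    proof (rule card_Union_disjoint)
      show "pairwise disjnt P" using P(1) by (simp add: partition_on_def)
      show "finite p" if "p \<in> P" for p using path [OF that] by auto
    qed
    then show ?thesis using UP cp P(3) by simp
  qed
  have choose: "2 * (n choose 2) = n * (n - 1)"
    by (cases n) (auto simp: choose_two)
  have cV: "card (verts ?H) = n choose 2"
  proof -
    have "verts ?H = {X. X \<subseteq> ?V \<and> card X = 2}"
      using fin finite_subset by (auto simp: token_graph_def)
    then show ?thesis using n_subsets [OF fin] by (simp add: n_def)
  qed
  \<comment> \<open>The \<open>k * (n - 1)\<close> edges number at most \<open>n choose 2\<close>;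
    cancel the positive factor \<open>n - 1\<close>.\<close>
  have k2: "2 * k \<le> n"
  proof -
    have "card (edges G) \<le> card {X. X \<subseteq> ?V \<and> card X = 2}"
      by (rule card_mono) (use fin ed in auto)
    then have "k * (n - 1) \<le> n choose 2" using n_subsets [OF fin] cE by (simp add: n_def)
    then have "(2 * k) * (n - 1) \<le> n * (n - 1)" using choose by linarith
    then show ?thesis using n2 by simp
  qed

  \<comment> \<open>Upper bound: token graphs of the Hamiltonian paths\<close>
  define S where "S = (\<lambda>p. token_graph 2 (?V, p)) ` P"
  have Ueq: "edges ?H = (\<Union>p\<in>P. edges (token_graph 2 (?V, p)))"
    using token_edges_Union [of ?V P] assms(1) unfolding UP by simp
  have "Q (card S)"
    unfolding Q_def
  proof (intro exI [of _ S] conjI ballI)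
    show "finite S" using P(2) by (simp add: S_def)
    show "(\<Union>K\<in>S. verts K) = verts ?H"
      using \<open>P \<noteq> {}\<close> by (auto simp: S_def token_graph_def)
    show "(\<Union>K\<in>S. edges K) = edges ?H" using Ueq by (simp add: S_def)
    fix K assume "K \<in> S"
    then obtain p where p: "p \<in> P" "K = token_graph 2 (?V, p)" by (auto simp: S_def)
    then obtain xs where xs: "distinct xs" "set xs = ?V" "p = path_edges xs" using path by blast
    have "simple_graph K"
      using simple_token_graph [OF path_graph_simple [OF xs(1)]] xs p by simp
    moreover have "edges K \<subseteq> edges ?H" using p Ueq by blast
    moreover have "verts K = verts ?H" by (simp add: p token_graph_def)
    ultimately show "subgraph K ?H" by (simp add: subgraph_def)
    show "planar K" using token_graph_path(1) [OF xs(1)] xs p by simp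
    show "enat 4 \<le> girth K" using token_graph_path(2) [OF xs(1)] xs p by (simp add: girth_ge_iff)
  qed simp
  \<comment> \<open>An inequality suffices: \<open>card S\<close> bounds the minimum from above, and
    the lower bound supplies the rest.\<close>
  moreover have "card S \<le> k" using card_image_le [OF P(2)] P(3) by (auto simp: S_def)

  \<comment> \<open>Lower bound: counting the edges of the parts\<close>
  moreover have "k \<le> m" if "Q m" for m
  proof -
    from \<open>Q m\<close> obtain S where "finite S \<and> card S = m \<and>
        (\<forall>K\<in>S. subgraph K ?H \<and> planar K \<and> enat 4 \<le> girth K) \<and>
        (\<Union>K\<in>S. verts K) = verts ?H \<and> (\<Union>K\<in>S. edges K) = edges ?H"
      unfolding Q_def ..
    then have S: "finite S" "card S = m"
        "\<And>K. K \<in> S \<Longrightarrow> subgraph K ?H \<and> planar K \<and> enat 4 \<le> girth K"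
        "(\<Union>K\<in>S. verts K) = verts ?H" "(\<Union>K\<in>S. edges K) = edges ?H"
      by simp_all
    have finH: "finite (verts ?H)" using simple_token_graph [OF assms(1)] by (simp add: simple_graph_def)
    have N: "2 \<le> n * (n - 1)" using n2 mult_le_mono [of 2 n 1 "n - 1"] by simp
    have bound: "card (edges K) \<le> n * (n - 1) - 2" if K: "K \<in> S" for K
    \<comment> \<open>The sparsity bound fails for the empty graph, which a family of subgraphs may
      contain.\<close>
    proof (cases "verts K = {}")
      case True
      have "edges K = {}"
        using S(3) [OF K] True by (fastforce simp: subgraph_def simple_graph_def)
      then show ?thesis by simp
    next
      case False
      have "card (edges K) + 2 \<le> 2 * card (verts K)"
        using S(3) [OF K] False by (intro planar_girth4_sparse) (auto simp: subgraph_def girth_ge_iff)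
      moreover have "card (verts K) \<le> card (verts ?H)"
        using S(3) [OF K] finH by (auto simp: subgraph_def intro: card_mono)
      ultimately show ?thesis using cV choose by linarith
    qed
    have "k * (n - 1) * (n - 2) \<le> card (edges ?H)"
      using card_token_edges [OF assms(1)] cE by (simp add: n_def)
    also have "\<dots> \<le> (\<Sum>K\<in>S. card (edges K))"
      unfolding S(5) [symmetric] by (rule card_UN_le [OF S(1)])
    also have "\<dots> \<le> m * (n * (n - 1) - 2)"
      using sum_bounded_above [of S "\<lambda>K. card (edges K)" "n * (n - 1) - 2"] bound S(2) by simp
    finally have count: "k * (n - 1) * (n - 2) \<le> m * (n * (n - 1) - 2)" .
    obtain r where r: "n = r + 2" using n2 by (metis add.commute le_Suc_ex)
    show "k \<le> m"
    \<comment> \<open>For \<open>n = 2\<close> the counting inequality is empty; here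
      \<open>k = 1\<close>, and the one vertex of the token graph forces a part.\<close>
    proof (cases "r = 0")
      case True
      then have "k = 1" using k2 r assms(2) by simp
      moreover have "S \<noteq> {}"
      proof
        assume "S = {}"
        then have "card (verts ?H) = 0" using S(4) by simp
        then show False using cV choose N by simp
      qed
      ultimately show ?thesis using S(1,2) by (auto simp: Suc_le_eq card_gt_0_iff)
    next
      case False
      have "n * (n - 1) - 2 = (r + 3) * r" by (simp add: r algebra_simps)
      then have "(k * (r + 1)) * r \<le> (m * (r + 3)) * r" using count by (simp add: r algebra_simps)
      then have 1: "k * (r + 1) \<le> m * (r + 3)" using False by simp
      show ?thesis
      proof (rule ccontr)
        \<comment> \<open>From \<open>m + 1 \<le> k\<close> the count gives
          \<open>r + 1 \<le> 2 * m\<close>, whereas \<open>2 * k \<le> r + 2\<close> gives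
          \<open>2 * m \<le> r\<close>.\<close>
        assume "\<not> k \<le> m"
        then have "(m + 1) * (r + 1) \<le> k * (r + 1)" by (intro mult_le_mono) auto
        then have "r + 1 \<le> 2 * m" using 1 by (simp add: algebra_simps)
        then show False using k2 \<open>\<not> k \<le> m\<close> r by linarith
      qed
    qed
  qed
  ultimately have "(LEAST m. Q m) = k"
    by (metis LeastI Least_le le_antisym order_trans)
  then show ?thesis by (simp add: girth_thickness_def Q_def)
qed

end
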